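(* For the parking process with screening on positions $x\in\{-2,-1,0,1,2\}$ with $N_t(-2)=N_t(2)=0$ for all $t$ (see context), let $\rho_\infty(x,r)$ be the end-density of site $(x,r)$ and, for $x\in\{-1,0,1\}$, let $p_x:=\lim_{r\to\infty}\rho_\infty(x,r)$. Then these limits exist, and the end-density of the center vertex tends to $$p_0=\lim_{r\to\infty}\rho_\infty(0,r)=\frac{10-\sqrt5}{19}\approx 0.408628,$$ and the same holds for the neighboring sites: $$p_{-1}=p_1=p_0=\frac{10-\sqrt5}{19}.$$
   Context: Parking process with screening (size 3). At positions $x\in\{-1,0,1\}$ particles arrive according to independent Poisson processes $N_t(x)$, $t\ge 0$, each of rate $1$; no particles arrive at positions $-2$ and $2$, i.e. $N_t(-2)=N_t(2)=0$. The occupancy is $\kappa_t(x,r)=1$ if there is a particle at site $(x,r)$ (position $x$, layer $r\ge1$) at time $t$, and $\kappa_t(x,r)=0$ otherwise. At time $0$ all sites are empty. For $x\in\{-1,0,1\}$ let $\mathcal{N}_x=\{x-1,x,x+1\}$ (the position $x$ and the positions at distance $1$ from it). When a particle arrives at position $x$ at time $t$, it is deposited at site $(x,h_t(x))$, where $$h_t(x)=1+\max\{r\ge 1:\ \exists\, y\in \mathcal{N}_x,\ \kappa_t(y,r)=1\},$$ evaluated on the configuration just before the arrival, with the maximum of the empty set taken to be $0$. Deposited particles stay forever. The density of site $(x,r)$ at time $t$ is $\rho_t(x,r)=E\,\kappa_t(x,r)$, and the end-density is $\rho_\infty(x,r)=\lim_{t\to\infty}\rho_t(x,r)$. *)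

theory Defs
  imports "HOL-Probability.Probability"
begin

section \<open>Poisson processes\<close>

text \<open>Counting paths are required for every outcome rather than almost every one.  Increments are
  differences of natural numbers; truncation does not occur because paths are nondecreasing.\<close>

definition poisson_process :: "'a measure \<Rightarrow> real \<Rightarrow> (real \<Rightarrow> 'a \<Rightarrow> nat) \<Rightarrow> bool" where
  "poisson_process M rate X \<longleftrightarrow>
     prob_space M \<and>
     (\<forall>t\<ge>0. X t \<in> measurable M (count_space UNIV)) \<and>
     (\<forall>\<omega>\<in>space M. X 0 \<omega> = 0 \<and> mono_on {0..} (\<lambda>t. X t \<omega>) \<and>
        (\<forall>t\<ge>0. continuous (at_right t) (\<lambda>s. X s \<omega>))) \<and>
     (\<forall>s t. 0 \<le> s \<and> s < t \<longrightarrow>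
        distr M (count_space UNIV) (\<lambda>\<omega>. X t \<omega> - X s \<omega>) = measure_pmf (poisson_pmf (rate * (t - s)))) \<and>
     (\<forall>(n::nat) \<tau>. 0 \<le> \<tau> 0 \<and> strict_mono_on {..n} \<tau> \<longrightarrow>
        prob_space.indep_vars M (\<lambda>_. count_space UNIV)
          (\<lambda>i \<omega>. X (\<tau> (Suc i)) \<omega> - X (\<tau> i) \<omega>) {..<n})"


section \<open>The parking process with screening\<close>

definition positions :: "int set" where
  "positions = {-2, -1, 0, 1, 2}"

definition nbhd :: "int \<Rightarrow> int set" where
  "nbhd x = {x - 1, x, x + 1}"

text \<open>A configuration \<open>c\<close> has \<open>c x r = 1\<close> if the site at position \<open>x\<close> and layer \<open>r\<close> is occupied, and
  \<open>c x r = 0\<close> otherwise.  Layers are numbered from \<open>1\<close>; layer \<open>0\<close> is never occupied.\<close>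

type_synonym config = "int \<Rightarrow> nat \<Rightarrow> nat"

definition drop_layer :: "config \<Rightarrow> int \<Rightarrow> nat" where
  "drop_layer c x =
     (let R = {r. 1 \<le> r \<and> (\<exists>y\<in>nbhd x. c y r = 1)} in 1 + (if R = {} then 0 else Max R))"

text \<open>Here \<open>n x t\<close> is the number of arrivals at position \<open>x\<close> in the time interval \<open>(0, t]\<close>, so the
  arrival times are the jump times of \<open>n x\<close>.\<close>

definition arrival :: "(int \<Rightarrow> real \<Rightarrow> nat) \<Rightarrow> int \<Rightarrow> real \<Rightarrow> bool" where
  "arrival n x s \<longleftrightarrow> 0 < s \<and> (\<forall>u. 0 \<le> u \<and> u < s \<longrightarrow> n x u < n x s)"

text \<open>All particles arriving at time \<open>s\<close> are deposited according to the configuration \<open>c\<close> just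
  before \<open>s\<close>.  Under independent Poisson arrivals there is almost surely at most one of them.\<close>

definition deposit :: "(int \<Rightarrow> real \<Rightarrow> nat) \<Rightarrow> real \<Rightarrow> config \<Rightarrow> config" where
  "deposit n s c =
     (\<lambda>x r. if x \<in> positions \<and> arrival n x s \<and> r = drop_layer c x then 1 else c x r)"

definition arrival_times :: "(int \<Rightarrow> real \<Rightarrow> nat) \<Rightarrow> real \<Rightarrow> real set" where
  "arrival_times n t = {s. 0 < s \<and> s \<le> t \<and> (\<exists>x\<in>positions. arrival n x s)}"

text \<open>The arrivals up to time \<open>t\<close> are processed in chronological order.  For counting paths the set
  \<open>arrival_times n t\<close> is finite, as \<open>sorted_list_of_set\<close> needs.\<close>

definition occupancy :: "(int \<Rightarrow> real \<Rightarrow> nat) \<Rightarrow> real \<Rightarrow> config" where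
  "occupancy n t = fold (deposit n) (sorted_list_of_set (arrival_times n t)) (\<lambda>x r. 0)"

locale screened_parking = prob_space M
  for M :: "'a measure" +
  fixes N :: "int \<Rightarrow> real \<Rightarrow> 'a \<Rightarrow> nat"
  assumes poisson: "x \<in> {-1, 0, 1} \<Longrightarrow> poisson_process M 1 (N x)"
    and indep: "indep_vars (\<lambda>_. Pi\<^sub>M {0..} (\<lambda>_. count_space UNIV))
                  (\<lambda>x \<omega>. \<lambda>t\<in>{0..}. N x t \<omega>) {-1, 0, 1}"
    and boundary: "x \<in> {-2, 2} \<Longrightarrow> t \<ge> 0 \<Longrightarrow> \<omega> \<in> space M \<Longrightarrow> N x t \<omega> = 0"

definition site_density ::
    "'a measure \<Rightarrow> (int \<Rightarrow> real \<Rightarrow> 'a \<Rightarrow> nat) \<Rightarrow> real \<Rightarrow> int \<Rightarrow> nat \<Rightarrow> real" where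
  "site_density M N t x r = (\<integral>\<omega>. real (occupancy (\<lambda>y s. N y s \<omega>) t x r) \<partial>M)"

definition end_density ::
    "'a measure \<Rightarrow> (int \<Rightarrow> real \<Rightarrow> 'a \<Rightarrow> nat) \<Rightarrow> int \<Rightarrow> nat \<Rightarrow> real" where
  "end_density M N x r = Lim at_top (\<lambda>t. site_density M N t x r)"

definition limit_density ::
    "'a measure \<Rightarrow> (int \<Rightarrow> real \<Rightarrow> 'a \<Rightarrow> nat) \<Rightarrow> int \<Rightarrow> real" where
  "limit_density M N x = lim (\<lambda>r. end_density M N x r)"

end

theory Submission imports Defs begin

text \<open>The proof reduces the process to uniformly chosen arrivals, and those to a linear recursion with an
  explicit stationary law.

  In the order of their arrival, particles choose positions in \<open>{-1, 0, 1}\<close> independently and uniformly, and the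
  end-density of a site is the probability that this infinite word ever fills it. Suppose that the
  center has just filled layer \<open>k\<close>. If \<open>i\<close> particles arrive at \<open>-1\<close> and \<open>j\<close> at \<open>1\<close> before the next
  one at the center, they fill the layers directly above \<open>k\<close> there, and then the center fills layer
  \<open>k + 1 + max i j\<close>. The layers filled by the center are thus a renewal sequence, and \<open>p\<^sub>0\<close> is the
  reciprocal of the mean increment. Between two arrivals at the center position \<open>1\<close> fills \<open>j\<close>
  layers, and \<open>j\<close> has mean \<open>1\<close>; hence \<open>p\<^sub>1 = p\<^sub>0\<close>.

  In place of a general renewal theorem, the chance that the center fills a layer is followed as
  a function of the number \<open>r\<close> of layers that are still missing and of the gap \<open>d\<close> between the two sides. The
  values for different gaps approach each other by a factor \<open>2/3\<close> per layer (\<open>contraction\<close>), because an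
  arrival at the center closes every gap. Their mean with respect to the stationary law of the gap is the
  same on every layer (\<open>charge_Suc\<close>), and this gives the value \<open>(10 - sqrt 5) / 19\<close>. For position \<open>1\<close>,
  \<open>hit_right_conv_lower_layer\<close> says that a layer is filled there with half the probability that the layer
  below it is filled at \<open>0\<close> or at \<open>1\<close>; so the probability at \<open>1\<close> has the same limit as the one at \<open>0\<close>.

  The passage from Poisson processes to words needs no conditioning on jump times. The interval
  \<open>[0, t]\<close> is divided into \<open>K\<close> equal cells, and for each cell one records the set of positions with an
  arrival in it. These sets are independent with explicit probabilities (\<open>prob_cell_word\<close>), and on every path
  they determine the occupancy at time \<open>t\<close> as soon as the cells separate the arrival times
  (\<open>eventually_occupancy_cell_word\<close>). Words with at most one arrival per cell are uniform once the
  number of arrivals is given, and other words disappear as \<open>K\<close> grows. As \<open>t\<close> grows the number of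
  arrivals exceeds every bound (\<open>occupancy_expectation_ge\<close>), which leaves the mean over long uniform words.\<close>

section \<open>A recursion over levels and gaps\<close>

text \<open>The smaller root \<open>q\<close> of \<open>q\<^sup>2 - 3 * q + 1 = 0\<close>. A symmetric simple random walk that is killed with
  probability \<open>1/3\<close> before each step dies at \<open>k\<close> with probability proportional to \<open>q\<close> to the power
  \<open>\<bar>k\<bar>\<close>; here the walk is the number of left arrivals minus the number of right arrivals since the last
  arrival at the center.\<close>

definition golden_decay :: real where
  "golden_decay = (3 - sqrt 5) / 2"

lemma golden_decay_bounds: "0 < golden_decay" "golden_decay < 1"
proof -
  have "sqrt 5 < sqrt (3\<^sup>2)" "sqrt 5 > sqrt (2\<^sup>2)" by (simp_all only: real_sqrt_less_iff) simp_all
  then show "0 < golden_decay" "golden_decay < 1"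
    by (simp_all add: golden_decay_def del: real_sqrt_abs real_sqrt_four)
qed

lemma golden_decay_quadratic: "3 * golden_decay - golden_decay\<^sup>2 = 1"
  by (simp add: golden_decay_def power2_eq_square field_simps)

lemma golden_decay_geometric_sum: "1 / (1 - golden_decay) = (1 + sqrt 5) / 2"
proof -
  have "(1 - golden_decay) * ((1 + sqrt 5) / 2) = 1"
    by (simp add: golden_decay_def field_simps)
  then show ?thesis using golden_decay_bounds by (simp add: field_simps)
qed

text \<open>Suppose that one side of the center is \<open>r\<close> layers below a target layer and the other side \<open>d\<close> layers
  below that. Then \<open>g r d\<close> is the chance that the center fills the target layer. An arrival at the
  center or at the higher side uses up a level, whereas an arrival at the lower side narrows the gap
  without using up a level; hence the term of level \<open>Suc r\<close> on the right of \<open>lagged\<close>. The row of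
  level \<open>0\<close> is chosen so that the first level needs no equation of its own: value \<open>1\<close> stands for a center
  that has just filled the target, value \<open>0\<close> for a side that has reached the target and blocks it.\<close>

locale lagged_recursion =
  fixes g :: "nat \<Rightarrow> nat \<Rightarrow> real"
  assumes start: "g 0 0 = 1" "g 0 (Suc d) = 0"
    and level: "g (Suc r) 0 = (g r 0 + 2 * g r 1) / 3"
    and lagged: "g (Suc r) (Suc d) = (g r 0 + g r (Suc (Suc d)) + g (Suc r) d) / 3"
begin

text \<open>An arrival at the center closes every gap, and from each gap it has at least the chance \<open>1/3\<close> to be the
  event that uses up the current level. So every value of level \<open>Suc r\<close> is \<open>1/3\<close> of the
  common value \<open>g r 0\<close> plus \<open>2/3\<close> of an average over level \<open>r\<close>.\<close>

lemma contraction: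
  assumes "\<And>d. lo \<le> g r d \<and> g r d \<le> hi"
  shows "(g r 0 + 2 * lo) / 3 \<le> g (Suc r) d \<and> g (Suc r) d \<le> (g r 0 + 2 * hi) / 3"
proof (induction d)
  case 0
  then show ?case using assms[of 1] by (simp add: level)
next
  case (Suc d)
  then show ?case using assms[of 0] assms[of "Suc (Suc d)"] by (simp add: lagged)
qed

lemma enclosure: "\<exists>lo hi. hi - lo = (2 / 3) ^ r \<and> (\<forall>d. lo \<le> g r d \<and> g r d \<le> hi)"
proof (induction r)
  case 0
  have "0 \<le> g 0 d \<and> g 0 d \<le> 1" for d using start by (cases d) auto
  then show ?case by (intro exI[of _ 0] exI[of _ 1]) auto
next
  case (Suc r)
  then obtain lo hi where *: "hi - lo = (2 / 3) ^ r" "\<And>d. lo \<le> g r d \<and> g r d \<le> hi" by blast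
  have "(g r 0 + 2 * hi) / 3 - (g r 0 + 2 * lo) / 3 = (2 / 3) ^ Suc r"
    using *(1) by (simp add: field_simps)
  then show ?case using contraction[OF *(2)] by blast
qed

lemma weighted_summable: "summable (\<lambda>d. golden_decay ^ d * g r (d + k))"
proof -
  obtain lo hi where *: "\<And>d. lo \<le> g r d \<and> g r d \<le> hi" using enclosure by blast
  show ?thesis
  proof (rule summable_comparison_test')
    show "summable (\<lambda>d. golden_decay ^ d * max \<bar>lo\<bar> \<bar>hi\<bar>)"
      using golden_decay_bounds by (intro summable_mult2 summable_geometric) auto
    show "norm (golden_decay ^ d * g r (d + k)) \<le> golden_decay ^ d * max \<bar>lo\<bar> \<bar>hi\<bar>" for d
      using golden_decay_bounds *[of "d + k"] by (auto simp: abs_mult intro!: mult_left_mono)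
  qed
qed

text \<open>The weights \<open>sqrt 5 / 2\<close> at gap \<open>0\<close> and \<open>golden_decay ^ d\<close> at gap \<open>Suc d\<close> form, up to
  normalization, the stationary law of the gap when time is counted in levels; therefore the weighted
  sum does not depend on the level. It makes the limit computable, whereas the contraction alone shows
  only that a limit exists.\<close>

definition charge :: "nat \<Rightarrow> real" where
  "charge r = sqrt 5 / 2 * g r 0 + (\<Sum>d. golden_decay ^ d * g r (Suc d))"

text \<open>Write \<open>q\<close> for \<open>golden_decay\<close>. Weighting \<open>lagged\<close> by \<open>q ^ d\<close> and summing over \<open>d\<close> relates shifted copies
  of the two weighted sums. After a multiplication by \<open>q\<close> the sum of the upper level has the factor
  \<open>3 * q - q\<^sup>2\<close>, which is \<open>1\<close> by the choice of \<open>q\<close>, and \<open>level\<close> removes the remaining boundary terms.\<close>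

lemma charge_Suc: "charge (Suc r) = charge r"
proof -
  let ?q = golden_decay
  let ?S = "\<lambda>r k. \<Sum>d. ?q ^ d * g r (d + k)"
  have split: "?S r k = g r k + ?q * ?S r (Suc k)" for r k
    using suminf_split_head[OF weighted_summable[of r k]]
      suminf_mult[OF weighted_summable[of r "Suc k"], of ?q] by (simp add: algebra_simps)
  have geo: "(\<Sum>d. ?q ^ d) = (1 + sqrt 5) / 2" "summable (\<lambda>d. ?q ^ d)"
    using suminf_geometric[of ?q] golden_decay_bounds golden_decay_geometric_sum
    by (simp_all add: summable_geometric)
  have "3 * ?S (Suc r) 1 = (\<Sum>d. ?q ^ d * g r 0 + ?q ^ d * g r (d + 2) + ?q ^ d * g (Suc r) (d + 0))"
  proof -
    have "3 * (?q ^ d * g (Suc r) (d + 1)) = ?q ^ d * g r 0 + ?q ^ d * g r (d + 2) + ?q ^ d * g (Suc r) (d + 0)" for d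
    proof -
      have "3 * (?q ^ d * g (Suc r) (d + 1)) = ?q ^ d * (3 * g (Suc r) (Suc d))" by simp
      also have "3 * g (Suc r) (Suc d) = g r 0 + g r (d + 2) + g (Suc r) (d + 0)"
        using lagged[of r d] by simp
      finally show ?thesis by (simp only: distrib_left)
    qed
    then show ?thesis using suminf_mult[OF weighted_summable[of "Suc r" 1], of 3] by simp
  qed
  also have "\<dots> = (1 + sqrt 5) / 2 * g r 0 + ?S r 2 + ?S (Suc r) 0"
    by (subst suminf_add[symmetric] suminf_mult2[symmetric];
        (intro summable_add summable_mult2 weighted_summable geo)?)+ (simp add: geo)
  finally have eq: "3 * ?S (Suc r) 1 = (1 + sqrt 5) / 2 * g r 0 + ?S r 2 + ?S (Suc r) 0" .
  have s1: "?S (Suc r) 0 = g (Suc r) 0 + ?q * ?S (Suc r) 1" and s2: "?S r 1 = g r 1 + ?q * ?S r 2"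
    using split[of "Suc r" 0] split[of r 1] by (simp_all add: numeral_2_eq_2)
  have "?q * (3 * ?S (Suc r) 1) = ?q * ((1 + sqrt 5) / 2 * g r 0) + ?q * ?S r 2 + ?q * g (Suc r) 0 + ?q\<^sup>2 * ?S (Suc r) 1"
    unfolding eq s1 by (simp add: algebra_simps power2_eq_square)
  then have "(3 * ?q - ?q\<^sup>2) * ?S (Suc r) 1 = ?q * ((1 + sqrt 5) / 2) * g r 0 + (?S r 1 - g r 1) + ?q * g (Suc r) 0"
    unfolding s2 by (simp add: algebra_simps)
  moreover have "?q * ((1 + sqrt 5) / 2) = (sqrt 5 - 1) / 2"
    by (simp add: golden_decay_def field_simps)
  ultimately have key: "?S (Suc r) 1 = (sqrt 5 - 1) / 2 * g r 0 + (?S r 1 - g r 1) + ?q * g (Suc r) 0"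
    using golden_decay_quadratic by simp
  have lev: "2 * g r 1 = 3 * g (Suc r) 0 - g r 0" using level[of r] by simp
  have "3 / 2 * g (Suc r) 0 = ?q * g (Suc r) 0 + sqrt 5 / 2 * g (Suc r) 0"
    by (simp add: golden_decay_def field_simps)
  moreover have "(sqrt 5 - 1) / 2 * g r 0 = sqrt 5 / 2 * g r 0 - g r 0 / 2"
    by (simp add: field_simps)
  ultimately have "sqrt 5 / 2 * g (Suc r) 0 + ?S (Suc r) 1 = sqrt 5 / 2 * g r 0 + ?S r 1"
    using key lev by linarith
  then show ?thesis by (simp add: charge_def)
qed

lemma charge_eq: "charge r = sqrt 5 / 2"
proof (induction r)
  case 0
  then show ?case by (simp add: charge_def start)
qed (simp add: charge_Suc)

text \<open>All values of level \<open>r\<close> lie in an interval of length \<open>(2/3) ^ r\<close>, and so does their weighted mean,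
  which is \<open>charge r\<close> over the total weight \<open>sqrt 5 / 2 + (1 + sqrt 5) / 2\<close>. This quotient is the limit.\<close>

lemma exponential_convergence: "\<bar>g r 0 - (10 - sqrt 5) / 19\<bar> \<le> (2 / 3) ^ r"
proof -
  obtain lo hi where *: "hi - lo = (2 / 3) ^ r" "\<And>d. lo \<le> g r d \<and> g r d \<le> hi"
    using enclosure by blast
  have geo: "(\<lambda>d. golden_decay ^ d * y) sums ((1 + sqrt 5) / 2 * y)" for y
    using sums_mult2[OF geometric_sums[of golden_decay], of y] golden_decay_bounds
      golden_decay_geometric_sum by simp
  have w: "(\<lambda>d. golden_decay ^ d * g r (Suc d)) sums (\<Sum>d. golden_decay ^ d * g r (Suc d))"
    using weighted_summable[of r 1] by (simp add: summable_sums)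
  have lower: "(1 + sqrt 5) / 2 * lo \<le> (\<Sum>d. golden_decay ^ d * g r (Suc d))"
    using *(2) golden_decay_bounds
    by (intro sums_le[OF _ geo w] mult_left_mono) auto
  have upper: "(\<Sum>d. golden_decay ^ d * g r (Suc d)) \<le> (1 + sqrt 5) / 2 * hi"
    using *(2) golden_decay_bounds
    by (intro sums_le[OF _ w geo] mult_left_mono) auto
  let ?mass = "sqrt 5 / 2 + (1 + sqrt 5) / 2" and ?p = "(10 - sqrt 5) / 19 :: real"
  have "?mass * lo \<le> charge r"
    using lower *(2)[of 0] mult_left_mono[of lo "g r 0" "sqrt 5 / 2"]
    unfolding charge_def distrib_right by (intro add_mono) auto
  moreover have "charge r \<le> ?mass * hi"
    using upper *(2)[of 0] mult_left_mono[of "g r 0" hi "sqrt 5 / 2"]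
    unfolding charge_def distrib_right by (intro add_mono) auto
  moreover have "charge r = ?mass * ?p" by (simp add: charge_eq field_simps)
  ultimately have "?mass * lo \<le> ?mass * ?p" "?mass * ?p \<le> ?mass * hi" by simp_all
  moreover have "?mass > 0" by (simp add: add_pos_pos)
  ultimately have "lo \<le> ?p" "?p \<le> hi" by (simp_all only: mult_le_cancel_left_pos)
  then show ?thesis unfolding *(1)[symmetric] abs_le_iff using *(2)[of 0] by linarith
qed

end

section \<open>Filling a target site by uniformly chosen arrivals\<close>

definition arrivable :: "int set" where
  "arrivable = {-1, 0, 1}"

lemma finite_arrivable [simp]: "finite arrivable"
  by (simp add: arrivable_def)

lemma card_arrivable [simp]: "card arrivable = 3"
  by (simp add: arrivable_def)

lemma sum_arrivable: "(\<Sum>y\<in>arrivable. f y) = f (-1) + f 0 + (f 1 :: real)"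
  by (simp add: arrivable_def)

text \<open>The future of the process depends on the configuration only through a pair: the highest occupied
  layer that position \<open>-1\<close> can see (at \<open>-1\<close> or \<open>0\<close>), and the highest one that position \<open>1\<close> can see (at
  \<open>0\<close> or \<open>1\<close>). The center sees the larger of the two, and an arrival there raises both. Both numbers
  are measured relative to a target layer, so that the target is layer \<open>0\<close>, empty space is the pair
  \<open>(- r, - r)\<close>, and invariance under a shift of layers needs no proof.\<close>

definition next_layer :: "int \<Rightarrow> int \<times> int \<Rightarrow> int" where
  "next_layer y s = 1 + (if y = -1 then fst s else if y = 1 then snd s else max (fst s) (snd s))"

definition move :: "int \<Rightarrow> int \<times> int \<Rightarrow> int \<times> int" where
  "move y s = (if y = -1 then (fst s + 1, snd s) else if y = 1 then (fst s, snd s + 1)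
     else (max (fst s) (snd s) + 1, max (fst s) (snd s) + 1))"

text \<open>The probability that one of the next \<open>m\<close> arrivals, at independent uniformly distributed positions,
  fills the target layer at position \<open>x\<close>.\<close>

primrec hit_within :: "int \<Rightarrow> nat \<Rightarrow> int \<times> int \<Rightarrow> real" where
  "hit_within x 0 s = 0"
| "hit_within x (Suc m) s =
     (\<Sum>y\<in>arrivable. if y = x \<and> next_layer y s = 0 then 1 else hit_within x m (move y s)) / 3"

lemma hit_within_bounds: "0 \<le> hit_within x m s \<and> hit_within x m s \<le> 1"
proof (induction m arbitrary: s)
  case (Suc m)
  show ?case using Suc[of "move (-1) s"] Suc[of "move 0 s"] Suc[of "move 1 s"]
    by (auto simp: sum_arrivable)
qed simp

lemma hit_within_Suc_mono: "hit_within x m s \<le> hit_within x (Suc m) s"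
proof (induction m arbitrary: s)
  case 0
  then show ?case using hit_within_bounds[of x "Suc 0" s] by simp
next
  case (Suc m)
  have "(\<Sum>y\<in>arrivable. if y = x \<and> next_layer y s = 0 then 1 else hit_within x m (move y s))
      \<le> (\<Sum>y\<in>arrivable. if y = x \<and> next_layer y s = 0 then 1 else hit_within x (Suc m) (move y s))"
    using Suc by (intro sum_mono) auto
  then show ?case by simp
qed

definition hit :: "int \<Rightarrow> int \<times> int \<Rightarrow> real" where
  "hit x s = lim (\<lambda>m. hit_within x m s)"

lemma hit_within_tendsto: "(\<lambda>m. hit_within x m s) \<longlonglongrightarrow> hit x s"
proof -
  have "Bseq (\<lambda>m. hit_within x m s)"
    using hit_within_bounds[of x _ s] by (intro BseqI'[of _ 1]) auto
  moreover have "monoseq (\<lambda>m. hit_within x m s)"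
    using hit_within_Suc_mono by (auto simp: monoseq_Suc)
  ultimately show ?thesis unfolding hit_def
    using Bseq_monoseq_convergent convergent_LIMSEQ_iff by blast
qed

lemma hit_bounds: "0 \<le> hit x s" "hit x s \<le> 1"
  using LIMSEQ_le_const[OF hit_within_tendsto, of 0 x s]
    LIMSEQ_le_const2[OF hit_within_tendsto, of x s 1] hit_within_bounds by blast+

lemma hit_first_step:
  "hit x s = (\<Sum>y\<in>arrivable. if y = x \<and> next_layer y s = 0 then 1 else hit x (move y s)) / 3"
proof -
  have "(\<lambda>m. if y = x \<and> next_layer y s = 0 then 1 else hit_within x m (move y s))
      \<longlonglongrightarrow> (if y = x \<and> next_layer y s = 0 then 1 else hit x (move y s))" for y
  proof (cases "y = x \<and> next_layer y s = 0")
    case True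
    show ?thesis unfolding if_P[OF True] by (rule tendsto_const)
  next
    case False
    show ?thesis unfolding if_not_P[OF False] by (rule hit_within_tendsto)
  qed
  then have "(\<lambda>m. hit_within x (Suc m) s)
      \<longlonglongrightarrow> (\<Sum>y\<in>arrivable. if y = x \<and> next_layer y s = 0 then 1 else hit x (move y s)) / 3"
    unfolding hit_within.simps by (intro tendsto_divide tendsto_sum tendsto_const) auto
  moreover have "(\<lambda>m. hit_within x (Suc m) s) \<longlonglongrightarrow> hit x s"
    using hit_within_tendsto by (rule LIMSEQ_Suc)
  ultimately show ?thesis by (rule LIMSEQ_unique[symmetric])
qed

text \<open>A position that already sees the target layer or a higher one can only deposit above it, and later
  arrivals do not lower what it sees.\<close>

lemma hit_within_covered:
  assumes "x \<in> arrivable" "1 \<le> next_layer x s"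
  shows "hit_within x m s = 0"
  using assms(2)
proof (induction m arbitrary: s)
  case (Suc m)
  have "1 \<le> next_layer x (move y s)" for y
    using Suc.prems assms(1) by (auto simp: next_layer_def move_def arrivable_def max_def split: if_splits)
  then have "hit_within x m (move y s) = 0" for y by (rule Suc.IH)
  then show ?case using Suc.prems by (auto intro!: sum.neutral)
qed simp

lemma hit_covered:
  assumes "x \<in> arrivable" "1 \<le> next_layer x s"
  shows "hit x s = 0"
  unfolding hit_def using hit_within_covered[OF assms] by simp

lemma hit_within_mirror: "hit_within (- x) m (prod.swap s) = hit_within x m s"
proof (induction m arbitrary: s)
  case (Suc m)
  have swap: "next_layer (- y) (prod.swap s) = next_layer y s"
    "move (- y) (prod.swap s) = prod.swap (move y s)" if "y \<in> arrivable" for y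
    using that by (auto simp: arrivable_def next_layer_def move_def max.commute)
  let ?term = "\<lambda>x y s. if y = x \<and> next_layer y s = 0 then 1 else hit_within x m (move y s)"
  have "(\<Sum>y\<in>arrivable. ?term (- x) y (prod.swap s)) = (\<Sum>y\<in>arrivable. ?term (- x) (- y) (prod.swap s))"
    by (simp add: sum_arrivable)
  also have "\<dots> = (\<Sum>y\<in>arrivable. ?term x y s)"
    by (intro sum.cong refl) (simp only: swap Suc neg_equal_iff_equal)
  finally have "(\<Sum>y\<in>arrivable. ?term (- x) y (prod.swap s)) = (\<Sum>y\<in>arrivable. ?term x y s)" .
  then show ?case by simp
qed simp

lemma hit_mirror: "hit (- x) (b, a) = hit x (a, b)"
  using hit_within_mirror[of x _ "(a, b)"] by (simp add: hit_def)

lemma hit_center_step: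
  "hit 0 (a, b) = (hit 0 (a + 1, b) + hit 0 (a, b + 1) +
     (if max a b = -1 then 1 else hit 0 (max a b + 1, max a b + 1))) / 3"
proof -
  have "next_layer 0 (a, b) = 0 \<longleftrightarrow> max a b = -1" unfolding next_layer_def by auto
  then show ?thesis
    using hit_first_step[of 0 "(a, b)"] by (simp add: sum_arrivable move_def)
qed

lemma hit_right_step:
  "hit 1 (a, b) = (hit 1 (a + 1, b) + (if b = -1 then 1 else hit 1 (a, b + 1)) +
     hit 1 (max a b + 1, max a b + 1)) / 3"
proof -
  have "next_layer 1 (a, b) = 0 \<longleftrightarrow> b = -1" unfolding next_layer_def by auto
  then show ?thesis
    using hit_first_step[of 1 "(a, b)"] by (simp add: sum_arrivable move_def)
qed

lemma hit_center_covered: "0 \<le> max a b \<Longrightarrow> hit 0 (a, b) = 0"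
  by (rule hit_covered) (auto simp: arrivable_def next_layer_def)

lemma hit_right_covered: "0 \<le> b \<Longrightarrow> hit 1 (a, b) = 0"
  by (rule hit_covered) (auto simp: arrivable_def next_layer_def)

text \<open>The function for which \<open>lagged_recursion\<close> was stated. Symmetry between the two sides allows the
  higher side to be put on the left.\<close>

definition center_profile :: "nat \<Rightarrow> nat \<Rightarrow> real" where
  "center_profile r d = (if r = 0 then (if d = 0 then 1 else 0) else hit 0 (- int r, - int r - int d))"

interpretation center: lagged_recursion center_profile
proof
  fix r d
  show "center_profile 0 0 = 1" "center_profile 0 (Suc d) = 0" by (simp_all add: center_profile_def)
  have sym: "hit 0 (a, b) = hit 0 (b, a)" for a b using hit_mirror[of 0 b a] by simp
  show "center_profile (Suc r) 0 = (center_profile r 0 + 2 * center_profile r 1) / 3"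
  proof (cases r)
    \<comment> \<open>At distance \<open>1\<close> from the target an arrival at the center fills it, which is the value \<open>1\<close> in row \<open>0\<close>.\<close>
    case 0
    then show ?thesis
      using hit_center_step[of "-1" "-1"] by (simp add: center_profile_def hit_center_covered)
  next
    case (Suc k)
    then show ?thesis
      using hit_center_step[of "- int r - 1" "- int r - 1"] sym[of "- int r" "- int r - 1"]
      by (simp add: center_profile_def algebra_simps)
  qed
  show "center_profile (Suc r) (Suc d) =
      (center_profile r 0 + center_profile r (Suc (Suc d)) + center_profile (Suc r) d) / 3"
  proof (cases r)
    case 0
    then show ?thesis
      using hit_center_step[of "-1" "-1 - int d - 1"]
      by (simp add: center_profile_def hit_center_covered algebra_simps)
  next
    case (Suc k)
    then show ?thesis
      using hit_center_step[of "- int (Suc r)" "- int (Suc r) - int (Suc d)"]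
        arg_cong[of "- int (Suc r) - int (Suc d)" "- int r - int (Suc (Suc d))" "\<lambda>b. hit 0 (- int r, b)"]
        arg_cong[of "- int (Suc r) - int (Suc d) + 1" "- int (Suc r) - int d" "\<lambda>b. hit 0 (- int (Suc r), b)"]
      by (simp add: center_profile_def)
  qed
qed

text \<open>Iterating the equation makes every value an arbitrarily small multiple of a bounded one. This gives
  uniqueness along states in which one coordinate can grow without limit.\<close>

lemma bounded_contraction_zero:
  fixes f :: "int \<Rightarrow> real"
  assumes "\<And>a. \<bar>f a\<bar> \<le> B" "\<And>a. f a = f (a + 1) / 3"
  shows "f a = 0"
proof -
  have f: "f a = f (a + int n) * (1/3) ^ n" for n
  proof (induction n)
    case (Suc n)
    then show ?case using assms(2)[of "a + int n"] by (simp add: algebra_simps)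
  qed simp
  have "\<bar>f a\<bar> \<le> B * (1/3) ^ n" for n
    by (subst f[of n]) (simp add: abs_mult mult_right_mono assms(1))
  moreover have "(\<lambda>n. B * (1/3::real) ^ n) \<longlonglongrightarrow> B * 0"
    by (intro tendsto_intros LIMSEQ_power_zero) auto
  ultimately show ?thesis using LIMSEQ_le_const by fastforce
qed

text \<open>When position \<open>1\<close> sees the layer just below the target, the next arrival at \<open>0\<close> or \<open>1\<close> decides: an
  arrival at \<open>1\<close> fills the target, an arrival at \<open>0\<close> covers it. Both are equally likely.\<close>

lemma hit_right_last_layer: "hit 1 (a, -1) = 1 / 2"
proof -
  have "hit 1 (a, -1) - 1 / 2 = 0"
  proof (rule bounded_contraction_zero[where f = "\<lambda>a. hit 1 (a, -1) - 1 / 2" and B = 2])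
    show "\<bar>hit 1 (a, -1) - 1 / 2\<bar> \<le> 2" for a using hit_bounds[of 1 "(a, -1)"] by auto
    show "hit 1 (a, -1) - 1 / 2 = (hit 1 (a + 1, -1) - 1 / 2) / 3" for a
      using hit_right_step[of a "-1"] by (simp add: hit_right_covered field_simps)
  qed
  then show ?thesis by simp
qed

text \<open>To fill the target, position \<open>1\<close> must first see the layer below it as the highest one, that is, this
  lower layer must be filled at \<open>1\<close> or at \<open>0\<close>; the two events exclude each other. From then on the chance
  is \<open>1/2\<close>. Formally, the difference \<open>D\<close> of the two sides, cut off at \<open>b = -1\<close>, satisfies the
  first-step equation without a source term, and is therefore zero by induction on the distance of \<open>b\<close> from
  the target.\<close>

lemma hit_right_conv_lower_layer:
  assumes "b \<le> -2"
  shows "hit 1 (a, b) = (hit 1 (a + 1, b + 1) + hit 0 (a + 1, b + 1)) / 2"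
proof -
  define D where "D a b = (if b \<ge> -1 then 0 else hit 1 (a, b) - (hit 1 (a + 1, b + 1) + hit 0 (a + 1, b + 1)) / 2)" for a b
  have *: "D a b = (D (a + 1) b + D a (b + 1) + D (max a b + 1) (max a b + 1)) / 3" if b: "b \<le> -2" for a b
  proof -
    \<comment> \<open>The source terms at \<open>b = -2\<close> and \<open>m = -2\<close> cancel against the value \<open>1/2\<close> of the last layer, so these
      cases are treated separately.\<close>
    define m where "m = max a b"
    have m: "max (a + 1) (b + 1) = m + 1" "m \<ge> b" by (simp_all add: m_def)
    note steps = hit_right_step[of a b, folded m_def] hit_right_step[of "a + 1" "b + 1", unfolded m(1)]
      hit_center_step[of "a + 1" "b + 1", unfolded m(1)]
    consider "b < -2" "m < -2" | "b < -2" "m = -2" | "b < -2" "m > -2" | "b = -2" "m = -2" | "b = -2" "m > -2"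
      using b m(2) by linarith
    then show ?thesis
      unfolding m_def[symmetric]
      using steps
      by cases (simp_all add: D_def hit_right_last_layer hit_right_covered hit_center_covered add.assoc field_simps)
  qed
  have "D a b = 0" for a b
  proof (cases "b \<ge> -1")
    case False
    then have "b \<le> -1" by simp
    then have "\<forall>a b'. b' \<ge> b \<longrightarrow> D a b' = 0"
    proof (induction b rule: int_le_induct)
      case base
      then show ?case by (simp add: D_def)
    next
      case (step b)
      have "D a (b - 1) = 0" for a
      proof (rule bounded_contraction_zero[where f = "\<lambda>a. D a (b - 1)" and B = 2])
        fix a
        have "\<bar>u - (v + w) / 2\<bar> \<le> 2" if "0 \<le> u" "u \<le> 1" "0 \<le> v" "v \<le> 1" "0 \<le> w" "w \<le> 1" for u v w :: real
          using that unfolding abs_le_iff by (simp add: field_simps)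
        from this[OF hit_bounds hit_bounds hit_bounds] show "\<bar>D a (b - 1)\<bar> \<le> 2"
          by (simp add: D_def)
        show "D a (b - 1) = D (a + 1) (b - 1) / 3"
          using *[of "b - 1" a] step by simp
      qed
      moreover have "b' = b - 1 \<or> b' \<ge> b" if "b' \<ge> b - 1" for b' using that by linarith
      ultimately show ?case using step.IH by blast
    qed
    then show ?thesis by blast
  qed (simp add: D_def)
  then have "D a b = 0" by blast
  then show ?thesis using assms by (simp add: D_def)
qed

definition right_profile :: "nat \<Rightarrow> real" where
  "right_profile r = (if r = 0 then 0 else hit 1 (- int r, - int r))"

lemma right_profile_Suc: "right_profile (Suc r) = (right_profile r + center_profile r 0) / 2"
  using hit_right_conv_lower_layer[of "- int (Suc r)" "- int (Suc r)"]
  by (cases r) (simp_all add: right_profile_def center_profile_def hit_right_last_layer)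

text \<open>By the preceding recursion \<open>right_profile\<close> follows \<open>center_profile\<close> with a forgetting factor \<open>1/2\<close>, so
  it has the same limit. The factor \<open>3\<close> is the least constant that the induction step reproduces.\<close>

lemma right_profile_convergence: "\<bar>right_profile r - (10 - sqrt 5) / 19\<bar> \<le> 3 * (2 / 3) ^ r"
proof (induction r)
  case 0
  have "\<bar>1 - (10 - sqrt 5) / 19\<bar> \<le> 1"
    using center.exponential_convergence[of 0] by (simp add: center_profile_def)
  then have "\<bar>0 - (10 - sqrt 5) / 19\<bar> \<le> 3 * (2 / 3) ^ 0"
    unfolding abs_le_iff power_0 by linarith
  then show ?case by (simp only: right_profile_def simp_thms if_True)
next
  case (Suc r)
  then show ?case using center.exponential_convergence[of r]
    unfolding right_profile_Suc power_Suc abs_le_iff by (simp add: field_simps)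
qed

lemma hit_limits:
  assumes "x \<in> arrivable"
  shows "(\<lambda>r. hit x (- int r, - int r)) \<longlonglongrightarrow> (10 - sqrt 5) / 19"
proof -
  let ?p = "(10 - sqrt 5) / 19 :: real"
  have limit: "(\<lambda>r. hit y (- int r, - int r)) \<longlonglongrightarrow> ?p"
    if "\<And>r. 1 \<le> r \<Longrightarrow> \<bar>hit y (- int r, - int r) - ?p\<bar> \<le> 3 * (2 / 3) ^ r" for y
  proof -
    have "(\<lambda>r. 3 * (2 / 3 :: real) ^ r) \<longlonglongrightarrow> 3 * 0"
      by (intro tendsto_intros LIMSEQ_power_zero) auto
    then have geo: "(\<lambda>r. 3 * (2 / 3 :: real) ^ r) \<longlonglongrightarrow> 0" by simp
    have "(\<lambda>r. hit y (- int r, - int r) - ?p) \<longlonglongrightarrow> 0"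
      by (rule Lim_null_comparison[OF eventually_sequentiallyI[of 1] geo]) (simp add: that)
    then show ?thesis by (rule LIM_zero_cancel)
  qed
  have "\<bar>hit 0 (- int r, - int r) - ?p\<bar> \<le> 3 * (2 / 3) ^ r" if "1 \<le> r" for r
    using that center.exponential_convergence[of r] zero_le_power[of "2/3::real" r]
    by (simp add: center_profile_def del: zero_le_power)
  then have center: "(\<lambda>r. hit 0 (- int r, - int r)) \<longlonglongrightarrow> ?p" by (rule limit)
  have "\<bar>hit 1 (- int r, - int r) - ?p\<bar> \<le> 3 * (2 / 3) ^ r" if "1 \<le> r" for r
    using that right_profile_convergence[of r] by (simp add: right_profile_def)
  then have right: "(\<lambda>r. hit 1 (- int r, - int r)) \<longlonglongrightarrow> ?p" by (rule limit)
  show ?thesis using assms center right hit_mirror[of 1] by (auto simp: arrivable_def)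
qed

section \<open>Skylines of configurations\<close>

text \<open>A set of positions instead of a single one, because a cell of a time interval may contain arrivals at
  several positions.\<close>

definition deposit_on :: "int set \<Rightarrow> config \<Rightarrow> config" where
  "deposit_on L c = (\<lambda>x r. if x \<in> L \<and> r = drop_layer c x then 1 else c x r)"

definition layers_at :: "config \<Rightarrow> int \<Rightarrow> nat set" where
  "layers_at c y = {r. 1 \<le> r \<and> c y r = 1}"

definition top_layer :: "config \<Rightarrow> int \<Rightarrow> nat" where
  "top_layer c y = Max (insert 0 (layers_at c y))"

text \<open>Holds for the empty configuration and is preserved by deposits at \<open>-1\<close>, \<open>0\<close> and \<open>1\<close>. Finiteness makes
  the maxima in \<open>drop_layer\<close> meaningful, and the empty screening positions contribute nothing to them.\<close>

definition admissible :: "config \<Rightarrow> bool" where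
  "admissible c \<longleftrightarrow> (\<forall>y. finite (layers_at c y)) \<and> (\<forall>y r. c y r \<in> {0, 1}) \<and>
     layers_at c (-2) = {} \<and> layers_at c 2 = {}"

lemma drop_layer_eq:
  assumes "admissible c"
  shows "drop_layer c x = 1 + max (max (top_layer c (x - 1)) (top_layer c x)) (top_layer c (x + 1))"
proof -
  let ?R = "{r. 1 \<le> r \<and> (\<exists>y\<in>nbhd x. c y r = 1)}"
  let ?C = "\<lambda>y. insert 0 (layers_at c y)"
  have R: "?R = layers_at c (x - 1) \<union> layers_at c x \<union> layers_at c (x + 1)"
    by (auto simp: layers_at_def nbhd_def)
  have fin: "finite (layers_at c y)" for y using assms by (simp add: admissible_def)
  have "(if ?R = {} then 0 else Max ?R) = Max (insert 0 ?R)"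
  proof (cases "?R = {}")
    case False
    then have "Max (insert 0 ?R) = max 0 (Max ?R)" unfolding R using fin by (intro Max_insert) auto
    then show ?thesis by (simp only: False if_False max_0L)
  qed (simp only: simp_thms if_True Max_singleton)
  also have "insert 0 ?R = ?C (x - 1) \<union> ?C x \<union> ?C (x + 1)" by (simp only: R) auto
  also have "Max \<dots> = max (max (top_layer c (x - 1)) (top_layer c x)) (top_layer c (x + 1))"
    unfolding top_layer_def using fin Max_Un[of "?C (x - 1) \<union> ?C x" "?C (x + 1)"] Max_Un[of "?C (x - 1)" "?C x"]
    by (simp only: finite_Un finite_insert insert_not_empty Un_empty simp_thms)
  finally show ?thesis by (simp only: drop_layer_def Let_def)
qed

lemma layers_at_deposit_on:
  "layers_at (deposit_on L c) z = (if z \<in> L then insert (drop_layer c z) (layers_at c z) else layers_at c z)"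
  by (auto simp: layers_at_def deposit_on_def drop_layer_def Let_def)

lemma top_layer_deposit_on:
  assumes "admissible c"
  shows "top_layer (deposit_on L c) z = (if z \<in> L then drop_layer c z else top_layer c z)"
proof -
  have fin: "finite (layers_at c z)" using assms by (simp add: admissible_def)
  have "top_layer c z \<le> drop_layer c z" using drop_layer_eq[OF assms, of z] by simp
  moreover have "Max (insert 0 (insert (drop_layer c z) (layers_at c z))) = max (drop_layer c z) (top_layer c z)"
    using fin Max_insert[of "insert 0 (layers_at c z)" "drop_layer c z"]
    by (simp add: top_layer_def insert_commute)
  ultimately show ?thesis using fin by (simp add: top_layer_def layers_at_deposit_on)
qed

lemma admissible_deposit_on:
  assumes "admissible c" "L \<subseteq> arrivable"
  shows "admissible (deposit_on L c)"
  using assms unfolding admissible_def layers_at_deposit_on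
  by (auto simp: deposit_on_def arrivable_def)

text \<open>The pair on which \<open>next_layer\<close> and \<open>move\<close> operate, for the target layer \<open>r\<close>.\<close>

definition skyline :: "nat \<Rightarrow> config \<Rightarrow> int \<times> int" where
  "skyline r c = (int (max (top_layer c (-1)) (top_layer c 0)) - int r,
                  int (max (top_layer c 0) (top_layer c 1)) - int r)"

lemma top_layer_screen:
  assumes "admissible c" shows "top_layer c (-2) = 0" "top_layer c 2 = 0"
  using assms by (simp_all add: admissible_def top_layer_def)

lemma drop_layer_skyline:
  assumes "admissible c" "y \<in> arrivable"
  shows "int (drop_layer c y) - int r = next_layer y (skyline r c)"
proof -
  consider "y = -1" | "y = 0" | "y = 1" using assms(2) by (auto simp: arrivable_def)
  then show ?thesis
    using top_layer_screen[OF assms(1)]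
    by cases (simp_all add: drop_layer_eq[OF assms(1)] next_layer_def skyline_def max_def)
qed

lemma skyline_deposit_on:
  assumes "admissible c" "y \<in> arrivable"
  shows "skyline r (deposit_on {y} c) = move y (skyline r c)"
proof -
  consider "y = -1" | "y = 0" | "y = 1" using assms(2) by (auto simp: arrivable_def)
  then show ?thesis
    using top_layer_screen[OF assms(1)]
    by cases (simp_all add: top_layer_deposit_on[OF assms(1)] drop_layer_eq[OF assms(1)] move_def
        skyline_def max_def)
qed

text \<open>The mean of \<open>f\<close> after \<open>m\<close> arrivals at independent uniformly distributed positions.\<close>

primrec word_mean :: "nat \<Rightarrow> (config \<Rightarrow> real) \<Rightarrow> config \<Rightarrow> real" where
  "word_mean 0 f c = f c"
| "word_mean (Suc m) f c = (\<Sum>y\<in>arrivable. word_mean m f (deposit_on {y} c)) / 3"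

lemma word_mean_nonneg: "(\<And>c. 0 \<le> f c) \<Longrightarrow> 0 \<le> word_mean m f c"
  by (induction m arbitrary: c) (auto intro!: sum_nonneg)

lemma word_mean_complement: "word_mean m (\<lambda>c. 1 - f c) c = 1 - word_mean m f c"
proof (induction m arbitrary: c)
  case (Suc m)
  then show ?case by (simp add: sum_subtractf diff_divide_distrib)
qed simp

definition site_indicator :: "int \<Rightarrow> nat \<Rightarrow> config \<Rightarrow> real" where
  "site_indicator x r c = of_bool (c x r = 1)"

lemma word_mean_occupied:
  "c x r = 1 \<Longrightarrow> word_mean m (site_indicator x r) c = 1"
proof (induction m arbitrary: c)
  case (Suc m)
  then have "deposit_on {y} c x r = 1" for y by (simp add: deposit_on_def)
  then have "word_mean m (site_indicator x r) (deposit_on {y} c) = 1" for y by (rule Suc.IH)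
  then show ?case by (simp add: sum_arrivable)
qed (simp add: site_indicator_def)

lemma word_mean_vacant:
  assumes "x \<in> arrivable" "admissible c" "c x r = 0"
  shows "word_mean m (site_indicator x r) c = hit_within x m (skyline r c)"
  using assms(2,3)
proof (induction m arbitrary: c)
  case (Suc m)
  have "word_mean m (site_indicator x r) (deposit_on {y} c) =
      (if y = x \<and> next_layer y (skyline r c) = 0 then 1 else hit_within x m (move y (skyline r c)))"
    if y: "y \<in> arrivable" for y
  proof (cases "y = x \<and> next_layer y (skyline r c) = 0")
    case True
    then have "deposit_on {y} c x r = 1"
      using drop_layer_skyline[OF Suc.prems(1) y, of r] by (auto simp: deposit_on_def)
    then have "word_mean m (site_indicator x r) (deposit_on {y} c) = 1" by (rule word_mean_occupied)
    then show ?thesis by (simp only: if_P[OF True])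
  next
    case False
    then have "deposit_on {y} c x r = 0"
      using drop_layer_skyline[OF Suc.prems(1) y, of r] Suc.prems(2) by (auto simp: deposit_on_def)
    then show ?thesis
      using False Suc.IH[OF admissible_deposit_on[OF Suc.prems(1), of "{y}"]] y
        skyline_deposit_on[OF Suc.prems(1) y] by auto
  qed
  then show ?case by simp
qed (simp add: site_indicator_def)

abbreviation empty_config :: config where
  "empty_config \<equiv> \<lambda>x r. 0"

lemma layers_at_empty_config: "layers_at empty_config y = {}"
  by (simp add: layers_at_def)

lemma word_mean_occupancy_tendsto:
  assumes "x \<in> arrivable"
  shows "(\<lambda>m. word_mean m (site_indicator x r) empty_config) \<longlonglongrightarrow> hit x (- int r, - int r)"
proof -
  have "admissible empty_config" by (simp add: admissible_def layers_at_empty_config)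
  moreover have "skyline r empty_config = (- int r, - int r)"
    by (simp add: skyline_def top_layer_def layers_at_empty_config)
  ultimately show ?thesis
    using word_mean_vacant[OF assms, of empty_config r] hit_within_tendsto by simp
qed

section \<open>Words over the cells of a time interval\<close>

text \<open>The probability that \<open>L\<close> is the set of positions with an arrival in a given cell, if each position
  independently has none with probability \<open>q\<close>.\<close>

definition cell_weight :: "real \<Rightarrow> int set \<Rightarrow> real" where
  "cell_weight q L = (\<Prod>x\<in>arrivable. if x \<in> L then 1 - q else q)"

primrec cell_mean :: "real \<Rightarrow> nat \<Rightarrow> (config \<Rightarrow> real) \<Rightarrow> config \<Rightarrow> real" where
  "cell_mean q 0 f c = f c"
| "cell_mean q (Suc K) f c = (\<Sum>L\<in>Pow arrivable. cell_weight q L * cell_mean q K f (deposit_on L c))"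

definition cell_words :: "nat \<Rightarrow> int set list set" where
  "cell_words K = {w. set w \<subseteq> Pow arrivable \<and> length w = K}"

lemma finite_cell_words: "finite (cell_words K)"
  unfolding cell_words_def by (rule finite_lists_length_eq) simp

lemma cell_mean_eq_sum_words:
  "cell_mean q K f c = (\<Sum>w\<in>cell_words K. prod_list (map (cell_weight q) w) * f (fold deposit_on w c))"
proof (induction K arbitrary: c)
  case 0
  have "cell_words 0 = {[]}" by (auto simp: cell_words_def)
  then show ?case by simp
next
  case (Suc K)
  have "cell_words (Suc K) = (\<lambda>(w, L). L # w) ` (cell_words K \<times> Pow arrivable)"
    unfolding cell_words_def by (rule lists_length_Suc_eq)
  moreover have "inj_on (\<lambda>(w, L). L # w) (cell_words K \<times> Pow arrivable)" by (auto simp: inj_on_def)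
  ultimately have "(\<Sum>w\<in>cell_words (Suc K). prod_list (map (cell_weight q) w) * f (fold deposit_on w c))
      = (\<Sum>w\<in>cell_words K. \<Sum>L\<in>Pow arrivable.
          cell_weight q L * (prod_list (map (cell_weight q) w) * f (fold deposit_on w (deposit_on L c))))"
    by (simp add: sum.reindex sum.cartesian_product case_prod_unfold mult.assoc)
  also have "\<dots> = cell_mean q (Suc K) f c"
    by (subst sum.swap) (simp add: Suc sum_distrib_left)
  finally show ?case by (rule sym)
qed

text \<open>Pascal's rule, applied to the first of \<open>Suc K\<close> cells: either it is empty, or it contains an arrival
  and shifts the sequence \<open>W\<close> by one.\<close>

lemma sum_binomial_Suc:
  fixes z :: real
  shows "(\<Sum>m\<le>Suc K. real (Suc K choose m) * z ^ m * W m) =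
    (\<Sum>m\<le>K. real (K choose m) * z ^ m * W m) + z * (\<Sum>m\<le>K. real (K choose m) * z ^ m * W (Suc m))"
proof -
  have "(\<Sum>m\<le>Suc K. real (Suc K choose m) * z ^ m * W m) =
      W 0 + (\<Sum>m\<le>K. real (K choose Suc m) * z ^ Suc m * W (Suc m))
        + (\<Sum>m\<le>K. real (K choose m) * z ^ Suc m * W (Suc m))"
    by (subst sum.atMost_Suc_shift) (simp add: sum.distrib[symmetric] algebra_simps)
  also have "W 0 + (\<Sum>m\<le>K. real (K choose Suc m) * z ^ Suc m * W (Suc m)) =
      (\<Sum>m\<le>Suc K. real (K choose m) * z ^ m * W m)"
    by (subst sum.atMost_Suc_shift) simp
  also have "\<dots> = (\<Sum>m\<le>K. real (K choose m) * z ^ m * W m)"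
    by simp
  finally show ?thesis by (simp add: sum_distrib_left algebra_simps)
qed

lemma cell_weight_empty: "cell_weight q {} = q ^ 3"
  by (simp add: cell_weight_def arrivable_def power3_eq_cube)

lemma cell_weight_single: "y \<in> arrivable \<Longrightarrow> cell_weight q {y} = (1 - q) * q\<^sup>2"
  by (auto simp: cell_weight_def arrivable_def power2_eq_square)

lemma cell_weight_nonneg: "0 \<le> q \<Longrightarrow> q \<le> 1 \<Longrightarrow> 0 \<le> cell_weight q L"
  unfolding cell_weight_def by (intro prod_nonneg) auto

lemma cell_mean_nonneg:
  assumes "0 \<le> q" "q \<le> 1" "\<And>c. 0 \<le> f c"
  shows "0 \<le> cell_mean q K f c"
  using assms
  by (induction K arbitrary: c) (auto intro!: sum_nonneg mult_nonneg_nonneg cell_weight_nonneg)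

text \<open>Only the words in which every letter is empty or a singleton are kept. A word with \<open>m\<close> singletons has
  weight \<open>q ^ (3 * K)\<close> times \<open>((1 - q) / q) ^ m\<close>, whatever the positions are; so, given their number, the
  arrivals are at independent uniformly distributed positions, and their mean is \<open>word_mean m f c\<close>.\<close>

lemma cell_mean_ge:
  assumes q: "0 < q" "q \<le> 1" and f: "\<And>c. 0 \<le> f c"
  shows "q ^ (3 * K) * (\<Sum>m\<le>K. real (K choose m) * (3 * ((1 - q) / q)) ^ m * word_mean m f c)
    \<le> cell_mean q K f c"
proof (induction K arbitrary: c)
  case (Suc K)
  let ?z = "3 * ((1 - q) / q)"
  let ?Z = "\<lambda>c. \<Sum>m\<le>K. real (K choose m) * ?z ^ m * word_mean m f c"
  have "(\<Sum>y\<in>arrivable. ?Z (deposit_on {y} c))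
      = (\<Sum>m\<le>K. real (K choose m) * ?z ^ m * (\<Sum>y\<in>arrivable. word_mean m f (deposit_on {y} c)))"
    unfolding sum_distrib_left by (rule sum.swap)
  also have "\<dots> = (\<Sum>m\<le>K. real (K choose m) * ?z ^ m * (3 * word_mean (Suc m) f c))"
    by simp
  also have "\<dots> = 3 * (\<Sum>m\<le>K. real (K choose m) * ?z ^ m * word_mean (Suc m) f c)"
    unfolding sum_distrib_left by (simp only: mult.left_commute)
  finally have shift: "(\<Sum>y\<in>arrivable. ?Z (deposit_on {y} c)) =
      3 * (\<Sum>m\<le>K. real (K choose m) * ?z ^ m * word_mean (Suc m) f c)" .
  have "q ^ 3 * ((1 - q) / q) = (1 - q) * q\<^sup>2"
    using q by (simp add: power3_eq_cube power2_eq_square)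
  then have "(q ^ 3 * ((1 - q) / q)) * (q ^ (3 * K) * (3 * w)) = (1 - q) * q\<^sup>2 * (q ^ (3 * K) * (3 * w))" for w
    by (rule arg_cong)
  then have single: "q ^ 3 * q ^ (3 * K) * (?z * w) = (1 - q) * q\<^sup>2 * (q ^ (3 * K) * (3 * w))" for w
    by (simp only: mult_ac)
  have add_cell: "q ^ (3 * Suc K) = q ^ 3 * q ^ (3 * K)" by (simp only: mult_Suc_right power_add)
  have "q ^ (3 * Suc K) * (\<Sum>m\<le>Suc K. real (Suc K choose m) * ?z ^ m * word_mean m f c)
      = q ^ 3 * (q ^ (3 * K) * ?Z c) + (1 - q) * q\<^sup>2 * (q ^ (3 * K) * (\<Sum>y\<in>arrivable. ?Z (deposit_on {y} c)))"
    unfolding sum_binomial_Suc add_cell distrib_left single shift by (simp only: mult.assoc)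
  also have "\<dots> = cell_weight q {} * (q ^ (3 * K) * ?Z c) +
      (\<Sum>y\<in>arrivable. cell_weight q {y} * (q ^ (3 * K) * ?Z (deposit_on {y} c)))"
    by (simp add: cell_weight_empty cell_weight_single sum_distrib_left)
  also have "\<dots> \<le> cell_weight q {} * cell_mean q K f c +
      (\<Sum>y\<in>arrivable. cell_weight q {y} * cell_mean q K f (deposit_on {y} c))"
    using q by (intro add_mono sum_mono mult_left_mono Suc.IH) (auto intro!: cell_weight_nonneg)
  also have "\<dots> = (\<Sum>L\<in>insert {} ((\<lambda>y. {y}) ` arrivable). cell_weight q L * cell_mean q K f (deposit_on L c))"
    by (subst sum.insert) (auto simp: sum.reindex deposit_on_def)
  also have "\<dots> \<le> cell_mean q (Suc K) f c"
    unfolding cell_mean.simps using q f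
    by (intro sum_mono2) (auto intro!: mult_nonneg_nonneg cell_weight_nonneg cell_mean_nonneg)
  finally show ?case .
qed simp

text \<open>For cells of length \<open>t / K\<close> the discarded words become negligible as \<open>K\<close> grows: for constant \<open>f\<close>
  and \<open>m0 = 0\<close> the bound tends to that constant. The sum over \<open>m < m0\<close> pays for words with too few arrivals, and is
  bounded independently of \<open>K\<close>.\<close>

lemma cell_mean_exp_ge:
  assumes t: "0 < t" and K: "0 < K" and f: "\<And>c. 0 \<le> f c"
    and l: "0 \<le> l" "\<And>m. m0 \<le> m \<Longrightarrow> l \<le> word_mean m f c"
  shows "exp (- 3 * t) * l * ((1 + 3 * t / real K) ^ K - (\<Sum>m<m0. (3 * t) ^ m))
    \<le> cell_mean (exp (- (t / real K))) K f c"
proof -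
  let ?q = "exp (- (t / real K))" and ?z = "3 * t / real K"
  have z: "0 \<le> ?z" "?z \<le> 3 * ((1 - ?q) / ?q)"
  proof -
    show "0 \<le> ?z" using t K by simp
    \<comment> \<open>The odds \<open>exp (t / K) - 1\<close> of an arrival are replaced by the smaller value \<open>t / K\<close>.\<close>
    have "(1 - ?q) / ?q = exp (t / real K) - 1" by (simp add: exp_minus divide_inverse left_diff_distrib)
    then have "t / real K \<le> (1 - ?q) / ?q"
      using exp_ge_add_one_self[of "t / real K"] by linarith
    then have "3 * (t / real K) \<le> 3 * ((1 - ?q) / ?q)" by (intro mult_left_mono) auto
    then show "?z \<le> 3 * ((1 - ?q) / ?q)" by (simp only: times_divide_eq_right)
  qed
  have q: "?q ^ (3 * K) = exp (- 3 * t)"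
    using K by (simp add: exp_of_nat_mult[symmetric])
  have binomial: "(1 + ?z) ^ K = (\<Sum>m\<le>K. real (K choose m) * ?z ^ m)"
    using binomial_ring[of ?z 1 K] by (simp only: add.commute[of 1 ?z] power_one mult_1_right)
  have few: "(\<Sum>m\<in>{..K} \<inter> {..<m0}. real (K choose m) * ?z ^ m) \<le> (\<Sum>m<m0. (3 * t) ^ m)"
  proof -
    have "real (K choose m) * ?z ^ m \<le> (3 * t) ^ m" if "m \<le> K" for m
    proof -
      have "real (K choose m) * ?z ^ m \<le> real (K ^ m) * ?z ^ m"
        using binomial_le_pow[OF that] z(1) by (intro mult_right_mono) (simp_all only: of_nat_le_iff zero_le_power)
      also have "\<dots> = (3 * t) ^ m" using K by (simp add: power_divide power_mult_distrib)
      finally show ?thesis .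
    qed
    then have "(\<Sum>m\<in>{..K} \<inter> {..<m0}. real (K choose m) * ?z ^ m) \<le> (\<Sum>m\<in>{..K} \<inter> {..<m0}. (3 * t) ^ m)"
      by (intro sum_mono) auto
    also have "\<dots> \<le> (\<Sum>m<m0. (3 * t) ^ m)" using t by (intro sum_mono2) auto
    finally show ?thesis .
  qed
  have "l * ((1 + ?z) ^ K - (\<Sum>m<m0. (3 * t) ^ m)) \<le>
      l * ((\<Sum>m\<le>K. real (K choose m) * ?z ^ m) - (\<Sum>m\<in>{..K} \<inter> {..<m0}. real (K choose m) * ?z ^ m))"
    using few l(1) unfolding binomial by (intro mult_left_mono) auto
  also have "\<dots> = (\<Sum>m\<in>{..K} - {..<m0}. real (K choose m) * ?z ^ m * l)"
    by (simp add: sum_diff[symmetric] Diff_Int sum_distrib_left mult.commute)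
  also have "\<dots> \<le> (\<Sum>m\<in>{..K} - {..<m0}. real (K choose m) * ?z ^ m * word_mean m f c)"
    using z(1) l by (intro sum_mono mult_left_mono) auto
  also have "\<dots> \<le> (\<Sum>m\<le>K. real (K choose m) * ?z ^ m * word_mean m f c)"
    using z(1) f by (intro sum_mono2) (auto intro!: mult_nonneg_nonneg word_mean_nonneg)
  also have "\<dots> \<le> (\<Sum>m\<le>K. real (K choose m) * (3 * ((1 - ?q) / ?q)) ^ m * word_mean m f c)"
    using z f by (intro sum_mono mult_right_mono mult_left_mono power_mono word_mean_nonneg) auto
  finally have "?q ^ (3 * K) * (l * ((1 + ?z) ^ K - (\<Sum>m<m0. (3 * t) ^ m))) \<le>
      ?q ^ (3 * K) * (\<Sum>m\<le>K. real (K choose m) * (3 * ((1 - ?q) / ?q)) ^ m * word_mean m f c)"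
    by (intro mult_left_mono) auto
  also have "\<dots> \<le> cell_mean ?q K f c"
    using t f by (intro cell_mean_ge) auto
  finally show ?thesis unfolding q by (simp only: mult.assoc)
qed

section \<open>Arrival times of counting paths\<close>

definition counting_path :: "(real \<Rightarrow> nat) \<Rightarrow> bool" where
  "counting_path f \<longleftrightarrow> mono_on {0..} f \<and> (\<forall>t\<ge>0. continuous (at_right t) f)"

lemma counting_pathD:
  assumes "counting_path f"
  shows "0 \<le> s \<Longrightarrow> s \<le> t \<Longrightarrow> f s \<le> f t"
    and "0 \<le> t \<Longrightarrow> \<exists>e>t. \<forall>u. t < u \<and> u < e \<longrightarrow> f u = f t"
proof -
  show "0 \<le> s \<Longrightarrow> s \<le> t \<Longrightarrow> f s \<le> f t"
    using assms by (auto simp: counting_path_def mono_on_def)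
  assume "0 \<le> t"
  then have "(f \<longlongrightarrow> f t) (at_right t)"
    using assms by (auto simp: counting_path_def continuous_within)
  then have "\<forall>\<^sub>F u in at_right t. f u = f t" by (simp add: tendsto_discrete)
  then show "\<exists>e>t. \<forall>u. t < u \<and> u < e \<longrightarrow> f u = f t"
    unfolding eventually_at_right_field by auto
qed

text \<open>The first time at which the path exceeds its value at \<open>a\<close> is an infimum, and right-continuity makes it
  attained; it is an arrival.\<close>

lemma arrival_if_increase:
  assumes path: "counting_path (n x)" and "0 \<le> a" "n x a < n x b" "a < b"
  shows "\<exists>s. a < s \<and> s \<le> b \<and> arrival n x s"
proof -
  define S where "S = {u. a \<le> u \<and> u \<le> b \<and> n x a < n x u}"
  define s where "s = Inf S"
  have b: "b \<in> S" using assms by (simp add: S_def)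
  have bdd: "bdd_below S" by (rule bdd_belowI[of _ a]) (simp add: S_def)
  have "a \<le> s" unfolding s_def using b by (intro cInf_greatest) (auto simp: S_def)
  have "s \<le> b" unfolding s_def using b bdd by (rule cInf_lower)
  have jump: "n x a < n x s"
  proof (rule ccontr)
    assume neg: "\<not> n x a < n x s"
    obtain e where e: "s < e" "\<And>u. s < u \<Longrightarrow> u < e \<Longrightarrow> n x u = n x s"
      using counting_pathD(2)[OF path, of s] \<open>a \<le> s\<close> \<open>0 \<le> a\<close> by auto
    obtain u where u: "u \<in> S" "u < e" using cInf_lessD[of S e] b e(1) by (auto simp: s_def)
    have "s \<le> u" unfolding s_def using u(1) bdd by (rule cInf_lower)
    then show False using u neg e(2)[of u] by (cases "u = s") (auto simp: S_def)
  qed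
  have before: "n x u < n x s" if "0 \<le> u" "u < s" for u
  proof (cases "u \<le> a")
    case True
    then show ?thesis using counting_pathD(1)[OF path, of u a] that jump by simp
  next
    case False
    have "u \<notin> S" using cInf_lower[OF _ bdd, of u] that(2) by (auto simp: s_def)
    then show ?thesis using False that(2) \<open>s \<le> b\<close> jump by (simp add: S_def)
  qed
  have "a < s" using jump \<open>a \<le> s\<close> by (cases "a = s") auto
  then show ?thesis using \<open>s \<le> b\<close> \<open>0 \<le> a\<close> before by (auto simp: arrival_def)
qed

lemma increase_if_arrival:
  assumes "counting_path (n x)" "0 \<le> a" "a < s" "s \<le> b" "arrival n x s"
  shows "n x a < n x b"
proof -
  have "n x a < n x s" using assms by (simp add: arrival_def)
  also have "\<dots> \<le> n x b" using assms by (intro counting_pathD(1)[OF assms(1)]) auto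
  finally show ?thesis .
qed

definition screened_paths :: "(int \<Rightarrow> real \<Rightarrow> nat) \<Rightarrow> bool" where
  "screened_paths n \<longleftrightarrow> (\<forall>x\<in>arrivable. counting_path (n x)) \<and> (\<forall>x\<in>{-2, 2}. \<forall>t\<ge>0. n x t = 0)"

lemma arrival_position:
  assumes "screened_paths n" "x \<in> positions" "arrival n x s"
  shows "x \<in> arrivable"
proof (rule ccontr)
  assume "x \<notin> arrivable"
  then have "x \<in> {-2, 2}" using assms(2) by (auto simp: positions_def arrivable_def)
  moreover have "0 < s" "n x 0 < n x s" using assms(3) by (simp_all add: arrival_def)
  ultimately show False using assms(1) by (auto simp: screened_paths_def)
qed

text \<open>A path takes different natural numbers at different arrivals, all of them bounded by its value at \<open>t\<close>.\<close>

lemma finite_arrival_times: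
  assumes "screened_paths n"
  shows "finite (arrival_times n t)"
proof -
  have "finite {s. 0 < s \<and> s \<le> t \<and> arrival n x s}" if "x \<in> arrivable" for x
  proof (rule inj_on_finite)
    show "inj_on (n x) {s. 0 < s \<and> s \<le> t \<and> arrival n x s}"
    proof (rule linorder_inj_onI)
      fix s u assume "s < u" "s \<in> {s. 0 < s \<and> s \<le> t \<and> arrival n x s}" "u \<in> {s. 0 < s \<and> s \<le> t \<and> arrival n x s}"
      then have "n x s < n x u" by (simp add: arrival_def)
      then show "n x s \<noteq> n x u" by simp
    qed auto
    show "n x ` {s. 0 < s \<and> s \<le> t \<and> arrival n x s} \<subseteq> {..n x t}"
      using that assms by (auto simp: screened_paths_def intro!: counting_pathD(1))
  qed simp
  then have "finite (\<Union>x\<in>arrivable. {s. 0 < s \<and> s \<le> t \<and> arrival n x s})" by (intro finite_UN_I finite_arrivable)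
  moreover have "arrival_times n t \<subseteq> (\<Union>x\<in>arrivable. {s. 0 < s \<and> s \<le> t \<and> arrival n x s})"
    using arrival_position[OF assms] by (auto simp: arrival_times_def)
  ultimately show ?thesis by (rule finite_subset[rotated])
qed

definition cell_letter :: "(int \<Rightarrow> real \<Rightarrow> nat) \<Rightarrow> real \<Rightarrow> real \<Rightarrow> int set" where
  "cell_letter n a b = {x \<in> arrivable. n x a < n x b}"

text \<open>A cell with at most one arrival time acts on the configuration through the set of positions whose
  paths increase over the cell. Several positions may share the arrival time; \<open>deposit\<close> then treats them
  simultaneously, as \<open>deposit_on\<close> does.\<close>

lemma occupancy_cell:
  assumes n: "screened_paths n" and ab: "0 \<le> a" "a < b"
    and single: "\<And>s s'. s \<in> arrival_times n b \<Longrightarrow> s' \<in> arrival_times n b \<Longrightarrow> a < s \<Longrightarrow> a < s' \<Longrightarrow> s = s'"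
  shows "occupancy n b = deposit_on (cell_letter n a b) (occupancy n a)"
proof (cases "\<exists>s\<in>arrival_times n b. a < s")
  case False
  then have "arrival_times n b = arrival_times n a"
    using ab by (fastforce simp: arrival_times_def)
  moreover have "cell_letter n a b = {}"
  proof -
    have "\<not> n x a < n x b" if x: "x \<in> arrivable" for x
    proof
      assume "n x a < n x b"
      then obtain s where "a < s" "s \<le> b" "arrival n x s"
        using arrival_if_increase[of n x a b] n x ab by (auto simp: screened_paths_def)
      then have "s \<in> arrival_times n b"
        using x by (auto simp: arrival_times_def arrival_def positions_def arrivable_def)
      then show False using False \<open>a < s\<close> by blast
    qed
    then show ?thesis by (auto simp: cell_letter_def)
  qed
  ultimately show ?thesis by (simp add: occupancy_def deposit_on_def)
next
  case True
  then obtain s where s: "s \<in> arrival_times n b" "a < s" by blast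
  have times: "arrival_times n b = insert s (arrival_times n a)"
  proof (intro set_eqI iffI)
    fix u assume u: "u \<in> arrival_times n b"
    show "u \<in> insert s (arrival_times n a)"
    proof (cases "a < u")
      case True
      then show ?thesis using single[OF u s(1)] s(2) by simp
    next
      case False
      then show ?thesis using u by (simp add: arrival_times_def)
    qed
  next
    fix u assume "u \<in> insert s (arrival_times n a)"
    then show "u \<in> arrival_times n b" using s(1) ab by (auto simp: arrival_times_def)
  qed
  have letter: "x \<in> cell_letter n a b \<longleftrightarrow> x \<in> positions \<and> arrival n x s" for x
  proof
    assume x: "x \<in> cell_letter n a b"
    then obtain u where u: "a < u" "u \<le> b" "arrival n x u"
      using arrival_if_increase[of n x a b] n ab by (auto simp: screened_paths_def cell_letter_def)
    have x': "x \<in> positions" using x by (auto simp: cell_letter_def arrivable_def positions_def)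
    then have "u \<in> arrival_times n b" using u by (auto simp: arrival_times_def arrival_def)
    then show "x \<in> positions \<and> arrival n x s" using single[OF _ s(1) u(1) s(2)] x' u by auto
  next
    assume x: "x \<in> positions \<and> arrival n x s"
    then have "x \<in> arrivable" using arrival_position[OF n] by blast
    moreover have "s \<le> b" using s(1) by (simp add: arrival_times_def)
    ultimately show "x \<in> cell_letter n a b"
      using increase_if_arrival[of n x a s b] x s(2) ab n by (auto simp: cell_letter_def screened_paths_def)
  qed
  have fin: "finite (arrival_times n a)" by (rule finite_arrival_times[OF n])
  have before: "\<forall>u\<in>arrival_times n a. u < s" using s(2) by (auto simp: arrival_times_def)
  have "sorted_list_of_set (arrival_times n b) = insort s (sorted_list_of_set (arrival_times n a))"
    unfolding times using fin before by (intro sorted_list_of_set_insert) auto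
  also have "\<dots> = sorted_list_of_set (arrival_times n a) @ [s]"
    using fin before by (intro sorted_insort_is_snoc) (auto intro: less_imp_le)
  finally have "occupancy n b = deposit n s (occupancy n a)" by (simp add: occupancy_def)
  then show ?thesis using letter by (simp add: deposit_def deposit_on_def)
qed

definition cell_word :: "(int \<Rightarrow> real \<Rightarrow> nat) \<Rightarrow> real \<Rightarrow> nat \<Rightarrow> int set list" where
  "cell_word n d K = map (\<lambda>k. cell_letter n (real k * d) (real (Suc k) * d)) [0..<K]"

lemma occupancy_cell_word:
  assumes n: "screened_paths n" and d: "0 < d"
    and single: "\<And>s s'. s \<in> arrival_times n (real K * d) \<Longrightarrow> s' \<in> arrival_times n (real K * d) \<Longrightarrow>
      \<bar>s - s'\<bar> < d \<Longrightarrow> s = s'"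
  shows "occupancy n (real K * d) = fold deposit_on (cell_word n d K) empty_config"
proof -
  have "occupancy n (real k * d) = fold deposit_on (cell_word n d k) empty_config" if "k \<le> K" for k
    using that
  proof (induction k)
    case 0
    have "arrival_times n 0 = {}" by (auto simp: arrival_times_def)
    then show ?case by (simp add: occupancy_def cell_word_def)
  next
    case (Suc k)
    have le: "real (Suc k) * d \<le> real K * d" using Suc.prems d by (intro mult_right_mono) auto
    have "occupancy n (real (Suc k) * d) =
        deposit_on (cell_letter n (real k * d) (real (Suc k) * d)) (occupancy n (real k * d))"
    proof (rule occupancy_cell[OF n])
      fix s s'
      assume s: "s \<in> arrival_times n (real (Suc k) * d)" "s' \<in> arrival_times n (real (Suc k) * d)"
        "real k * d < s" "real k * d < s'"
      then have "\<bar>s - s'\<bar> < d" by (auto simp: arrival_times_def algebra_simps)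
      moreover have "s \<in> arrival_times n (real K * d)" "s' \<in> arrival_times n (real K * d)"
        using s le by (auto simp: arrival_times_def)
      ultimately show "s = s'" using single by blast
    qed (use d in \<open>auto simp: algebra_simps\<close>)
    then show ?case using Suc by (simp add: cell_word_def)
  qed
  then show ?thesis by blast
qed

text \<open>Finitely many arrival times are separated by every sufficiently fine division of the interval. This
  holds for every path, not only for almost every path: the occupancy is thus a pointwise limit of functions of finitely many
  increments, and is measurable even if the underlying measure is not complete.\<close>

lemma eventually_occupancy_cell_word:
  assumes n: "screened_paths n" and t: "0 < t"
  shows "\<forall>\<^sub>F K in sequentially. occupancy n t = fold deposit_on (cell_word n (t / real K) K) empty_config"
proof -
  define gaps where "gaps = (\<lambda>(s, s'). \<bar>s - s'\<bar>) ` {(s, s'). s \<in> arrival_times n t \<and> s' \<in> arrival_times n t \<and> s \<noteq> s'}"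
  have "finite {(s, s'). s \<in> arrival_times n t \<and> s' \<in> arrival_times n t \<and> s \<noteq> s'}"
    by (rule finite_subset[of _ "arrival_times n t \<times> arrival_times n t"])
      (auto simp: finite_arrival_times[OF n])
  then have fin: "finite gaps" by (simp add: gaps_def)
  \<comment> \<open>The element \<open>1\<close> keeps the minimum defined if there are fewer than two arrival times.\<close>
  define e where "e = Min (insert 1 gaps)"
  have e: "0 < e" using fin by (auto simp: e_def gaps_def)
  have "(\<lambda>K. t / real K) \<longlonglongrightarrow> 0" by (rule lim_const_over_n)
  then have "\<forall>\<^sub>F K in sequentially. t / real K < e" using e by (rule order_tendstoD)
  moreover have "\<forall>\<^sub>F K in sequentially. 0 < K" by (rule eventually_gt_at_top)
  ultimately show ?thesis
  proof eventually_elim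
    case (elim K)
    have Kt: "real K * (t / real K) = t" using elim by simp
    have "occupancy n (real K * (t / real K)) = fold deposit_on (cell_word n (t / real K) K) empty_config"
    proof (rule occupancy_cell_word[OF n])
      fix s s' assume s: "s \<in> arrival_times n (real K * (t / real K))"
        "s' \<in> arrival_times n (real K * (t / real K))" "\<bar>s - s'\<bar> < t / real K"
      show "s = s'"
      proof (rule ccontr)
        assume "s \<noteq> s'"
        then have "\<bar>s - s'\<bar> \<in> gaps" using s unfolding Kt gaps_def by force
        then have "e \<le> \<bar>s - s'\<bar>" unfolding e_def using fin by (intro Min_le) auto
        then show False using s(3) elim by simp
      qed
    qed (use t elim in auto)
    then show ?case by (simp only: Kt)
  qed
qed

lemma cell_word_in_cell_words: "cell_word n d K \<in> cell_words K"
  by (auto simp: cell_word_def cell_words_def cell_letter_def)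

lemma admissible_fold_deposit_on:
  "set w \<subseteq> Pow arrivable \<Longrightarrow> admissible (fold deposit_on w empty_config)"
proof (induction w rule: rev_induct)
  case Nil
  then show ?case by (simp add: admissible_def layers_at_empty_config)
next
  case (snoc L w)
  then show ?case by (simp add: admissible_deposit_on)
qed

lemma admissible_occupancy:
  assumes "screened_paths n" "0 < t"
  shows "admissible (occupancy n t)"
proof -
  obtain K where "occupancy n t = fold deposit_on (cell_word n (t / real K) K) empty_config"
    using eventually_happens[OF eventually_occupancy_cell_word[OF assms]] by auto
  then show ?thesis
    using admissible_fold_deposit_on cell_word_in_cell_words by (simp add: cell_words_def)
qed

section \<open>Poisson arrivals and the end-densities\<close>

context screened_parking
begin

abbreviation sample :: "'a \<Rightarrow> int \<Rightarrow> real \<Rightarrow> nat" where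
  "sample \<omega> \<equiv> \<lambda>x t. N x t \<omega>"

lemma screened_paths_sample:
  assumes "\<omega> \<in> space M"
  shows "screened_paths (sample \<omega>)"
  unfolding screened_paths_def
proof (intro conjI ballI allI impI)
  fix x assume "x \<in> arrivable"
  then have "poisson_process M 1 (N x)" by (intro poisson) (simp add: arrivable_def)
  then show "counting_path (\<lambda>t. N x t \<omega>)"
    using assms by (auto simp: poisson_process_def counting_path_def)
next
  fix x :: int and t :: real assume "x \<in> {-2, 2}" "0 \<le> t"
  then show "N x t \<omega> = 0" by (rule boundary[OF _ _ assms])
qed

text \<open>The increments of one process over the cells are independent Poisson variables of mean \<open>d\<close>, so each
  vanishes with probability \<open>exp (- d)\<close>.\<close>

lemma prob_cell_pattern:
  assumes x: "x \<in> arrivable" and d: "0 < d" and K: "0 < K"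
  shows "prob {\<omega> \<in> space M. \<forall>k<K. (N x (real k * d) \<omega> < N x (real (Suc k) * d) \<omega>) = P k} =
    (\<Prod>k<K. if P k then 1 - exp (- d) else exp (- d))"
proof -
  define inc where "inc k \<omega> = N x (real (Suc k) * d) \<omega> - N x (real k * d) \<omega>" for k \<omega>
  have pp: "poisson_process M 1 (N x)" using x by (intro poisson) (simp add: arrivable_def)
  then have meas: "N x t \<in> measurable M (count_space UNIV)" if "0 \<le> t" for t
    using that by (simp add: poisson_process_def)
  have inc_meas: "inc k \<in> measurable M (count_space UNIV)" for k
  proof -
    have "N x (real k * d) \<in> measurable M (count_space UNIV)"
      "N x (real (Suc k) * d) \<in> measurable M (count_space UNIV)"
      using d by (auto intro!: meas)
    then show ?thesis unfolding inc_def by measurable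
  qed
  have mono: "strict_mono_on {..K} (\<lambda>k. real k * d)"
    using d by (auto simp: strict_mono_on_def)
  have indep: "indep_vars (\<lambda>_. count_space UNIV) inc {..<K}"
    using pp mono d unfolding poisson_process_def inc_def
    by (elim conjE allE[of _ K] allE[of _ "\<lambda>k. real k * d"]) auto
  have event: "{\<omega> \<in> space M. \<forall>k<K. (N x (real k * d) \<omega> < N x (real (Suc k) * d) \<omega>) = P k} =
      (\<Inter>k\<in>{..<K}. inc k -` {m. (0 < m) = P k} \<inter> space M)"
    using K by (auto simp: inc_def)
  have law: "prob (inc k -` {m. (0 < m) = P k} \<inter> space M) = (if P k then 1 - exp (- d) else exp (- d))" for k
  proof -
    have "distr M (count_space UNIV) (inc k) = measure_pmf (poisson_pmf (1 * (real (Suc k) * d - real k * d)))"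
      using pp d unfolding poisson_process_def inc_def by (simp add: algebra_simps)
    then have distr: "distr M (count_space UNIV) (inc k) = measure_pmf (poisson_pmf d)"
      by (simp add: algebra_simps)
    have "prob (inc k -` {m. (0 < m) = P k} \<inter> space M) = measure (distr M (count_space UNIV) (inc k)) {m. (0 < m) = P k}"
      using inc_meas by (intro measure_distr[symmetric]) auto
    also have "\<dots> = measure_pmf.prob (poisson_pmf d) {m. (0 < m) = P k}" by (simp add: distr)
    also have "\<dots> = (if P k then 1 - exp (- d) else exp (- d))"
    proof (cases "P k")
      case True
      then have "{m::nat. (0 < m) = P k} = UNIV - {0}" by auto
      then show ?thesis using True d measure_pmf.prob_compl[of "{0}" "poisson_pmf d"]
        by (simp add: measure_pmf_single pmf_poisson)
    next
      case False
      then have "{m::nat. (0 < m) = P k} = {0}" by auto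
      then show ?thesis using False d by (simp add: measure_pmf_single pmf_poisson)
    qed
    finally show ?thesis .
  qed
  have "prob (\<Inter>k\<in>{..<K}. inc k -` {m. (0 < m) = P k} \<inter> space M) =
      (\<Prod>k<K. prob (inc k -` {m. (0 < m) = P k} \<inter> space M))"
    using K by (intro indep_varsD[OF indep, of "{..<K}" "\<lambda>k. {m. (0 < m) = P k}"]) auto
  then show ?thesis by (simp only: event law)
qed

text \<open>Independence of the three processes is combined with independence of the increments of each of them:
  the probability is a product over positions of products over cells, and exchanging the two products
  gives one factor \<open>cell_weight\<close> for each cell.\<close>

lemma prob_cell_word:
  assumes d: "0 < d" and K: "0 < K" and w: "w \<in> cell_words K"
  shows "{\<omega> \<in> space M. cell_word (sample \<omega>) d K = w} \<in> events"
    and "prob {\<omega> \<in> space M. cell_word (sample \<omega>) d K = w} = prod_list (map (cell_weight (exp (- d))) w)"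
proof -
  define X where "X x \<omega> = (\<lambda>t\<in>{0..}. N x t \<omega>)" for x \<omega>
  let ?P = "Pi\<^sub>M {0..} (\<lambda>_. count_space UNIV) :: (real \<Rightarrow> nat) measure"
  define B where "B x = {f \<in> space ?P. \<forall>k\<in>{..<K}. (f (real k * d) < f (real (Suc k) * d)) = (x \<in> w ! k)}" for x
  have B: "B x \<in> sets ?P" for x
  proof -
    have comp: "(\<lambda>f. f t) \<in> measurable ?P (count_space UNIV)" if "0 \<le> t" for t
      using that by (intro measurable_component_singleton) simp
    have pred: "Measurable.pred ?P (\<lambda>f. (f (real k * d) < f (real (Suc k) * d)) = (x \<in> w ! k))" for k
    proof -
      \<comment> \<open>One coordinate is fixed to a number \<open>m\<close> first; the countably many values of \<open>m\<close> are then put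
        together.\<close>
      have "(\<lambda>f. (m < f (real (Suc k) * d)) = (x \<in> w ! k)) \<in> measurable ?P (count_space UNIV)" for m
        using d by (intro measurable_compose[OF comp]) auto
      then show ?thesis
        by (rule measurable_compose_countable[OF _ comp]) (use d in auto)
    qed
    from pred show ?thesis unfolding B_def by (intro sets.sets_Collect_finite_All) (auto simp: pred_def)
  qed
  have indepX: "indep_vars (\<lambda>_. ?P) X arrivable"
    using indep by (simp add: X_def[abs_def] arrivable_def)
  have pre: "X x -` B x \<inter> space M =
      {\<omega> \<in> space M. \<forall>k<K. (N x (real k * d) \<omega> < N x (real (Suc k) * d) \<omega>) = (x \<in> w ! k)}" for x
    using d by (auto simp: B_def X_def space_PiM)
  have len: "length w = K" using w by (simp add: cell_words_def)
  have sub: "w ! k \<subseteq> arrivable" if "k < K" for k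
  proof -
    have "w ! k \<in> set w" using that len by simp
    then show ?thesis using w unfolding cell_words_def by blast
  qed
  have word: "cell_word (sample \<omega>) d K = w \<longleftrightarrow>
      (\<forall>x\<in>arrivable. \<forall>k<K. (N x (real k * d) \<omega> < N x (real (Suc k) * d) \<omega>) = (x \<in> w ! k))" for \<omega>
  proof -
    have "cell_word (sample \<omega>) d K = w \<longleftrightarrow>
        (\<forall>k<K. cell_letter (sample \<omega>) (real k * d) (real (Suc k) * d) = w ! k)"
      by (simp add: cell_word_def list_eq_iff_nth_eq len)
    also have "\<dots> \<longleftrightarrow> (\<forall>k<K. \<forall>x\<in>arrivable. (N x (real k * d) \<omega> < N x (real (Suc k) * d) \<omega>) = (x \<in> w ! k))"
    proof (intro all_cong)
      fix k assume "k < K"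
      then have "w ! k \<subseteq> arrivable" by (rule sub)
      then show "cell_letter (sample \<omega>) (real k * d) (real (Suc k) * d) = w ! k \<longleftrightarrow>
          (\<forall>x\<in>arrivable. (N x (real k * d) \<omega> < N x (real (Suc k) * d) \<omega>) = (x \<in> w ! k))"
        unfolding cell_letter_def by blast
    qed
    finally show ?thesis by blast
  qed
  have event: "{\<omega> \<in> space M. cell_word (sample \<omega>) d K = w} = (\<Inter>x\<in>arrivable. X x -` B x \<inter> space M)"
    unfolding word pre by (auto simp: arrivable_def)
  have "X x \<in> measurable M ?P" if "x \<in> arrivable" for x
    using indepX that by (auto simp: indep_vars_def)
  then have ev: "X x -` B x \<inter> space M \<in> events" if "x \<in> arrivable" for x
    using that B by (intro measurable_sets)
  show "{\<omega> \<in> space M. cell_word (sample \<omega>) d K = w} \<in> events"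
    unfolding event by (rule sets.finite_INT) (auto simp: ev arrivable_def)
  have "prob {\<omega> \<in> space M. cell_word (sample \<omega>) d K = w} = (\<Prod>x\<in>arrivable. prob (X x -` B x \<inter> space M))"
    unfolding event using B by (intro indep_varsD[OF indepX]) (auto simp: arrivable_def)
  also have "\<dots> = (\<Prod>x\<in>arrivable. \<Prod>k<K. if x \<in> w ! k then 1 - exp (- d) else exp (- d))"
    unfolding pre using d K by (intro prod.cong refl prob_cell_pattern)
  also have "\<dots> = (\<Prod>k<K. cell_weight (exp (- d)) (w ! k))"
    unfolding cell_weight_def by (rule prod.swap)
  also have "\<dots> = prod_list (map (cell_weight (exp (- d))) w)"
    using w by (simp add: prod.list_conv_set_nth cell_words_def atLeast0LessThan)
  finally show "prob {\<omega> \<in> space M. cell_word (sample \<omega>) d K = w} = prod_list (map (cell_weight (exp (- d))) w)" .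
qed

lemma cell_word_expectation:
  fixes f :: "config \<Rightarrow> real"
  assumes d: "0 < d" and K: "0 < K"
  shows "(\<lambda>\<omega>. f (fold deposit_on (cell_word (sample \<omega>) d K) empty_config)) \<in> borel_measurable M"
    and "(\<integral>\<omega>. f (fold deposit_on (cell_word (sample \<omega>) d K) empty_config) \<partial>M) =
      cell_mean (exp (- d)) K f empty_config"
proof -
  let ?A = "\<lambda>w. {\<omega> \<in> space M. cell_word (sample \<omega>) d K = w}"
  let ?f = "\<lambda>w. f (fold deposit_on w empty_config)"
  have expand: "?f (cell_word (sample \<omega>) d K) = (\<Sum>w\<in>cell_words K. ?f w * indicator (?A w) \<omega>)"
    if "\<omega> \<in> space M" for \<omega>
  proof -
    have "(\<Sum>w\<in>cell_words K. ?f w * indicator (?A w) \<omega>) =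
        (\<Sum>w\<in>cell_words K. if w = cell_word (sample \<omega>) d K then ?f w else 0)"
      using that by (intro sum.cong) (auto simp: indicator_def)
    then show ?thesis using cell_word_in_cell_words by (simp add: sum.delta' finite_cell_words)
  qed
  have A: "?A w \<in> events" if "w \<in> cell_words K" for w by (rule prob_cell_word(1)[OF d K that])
  have "(\<lambda>\<omega>. \<Sum>w\<in>cell_words K. ?f w * indicator (?A w) \<omega>) \<in> borel_measurable M"
    using A by (intro borel_measurable_sum borel_measurable_times borel_measurable_const borel_measurable_indicator) auto
  then show "(\<lambda>\<omega>. ?f (cell_word (sample \<omega>) d K)) \<in> borel_measurable M"
    using measurable_cong[of M "\<lambda>\<omega>. ?f (cell_word (sample \<omega>) d K)"] expand by auto
  have "(\<integral>\<omega>. ?f (cell_word (sample \<omega>) d K) \<partial>M) = (\<integral>\<omega>. (\<Sum>w\<in>cell_words K. ?f w * indicator (?A w) \<omega>) \<partial>M)"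
    by (intro Bochner_Integration.integral_cong refl expand)
  also have "\<dots> = (\<Sum>w\<in>cell_words K. \<integral>\<omega>. ?f w * indicator (?A w) \<omega> \<partial>M)"
    using A by (intro Bochner_Integration.integral_sum integrable_mult_right integrable_real_indicator) (auto simp: emeasure_eq_measure)
  also have "\<dots> = (\<Sum>w\<in>cell_words K. prod_list (map (cell_weight (exp (- d))) w) * ?f w)"
    using A prob_cell_word(2)[OF d K] by (intro sum.cong) (auto simp: sets.Int_space_eq1 mult.commute)
  also have "\<dots> = cell_mean (exp (- d)) K f empty_config" by (rule cell_mean_eq_sum_words[symmetric])
  finally show "(\<integral>\<omega>. ?f (cell_word (sample \<omega>) d K) \<partial>M) = cell_mean (exp (- d)) K f empty_config" .
qed

lemma occupancy_expectation:
  fixes f :: "config \<Rightarrow> real"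
  assumes t: "0 < t" and f: "\<And>c. 0 \<le> f c" "\<And>c. f c \<le> 1"
  shows "integrable M (\<lambda>\<omega>. f (occupancy (sample \<omega>) t))"
    and "(\<lambda>K. cell_mean (exp (- (t / real (Suc K)))) (Suc K) f empty_config)
      \<longlonglongrightarrow> (\<integral>\<omega>. f (occupancy (sample \<omega>) t) \<partial>M)"
proof -
  let ?F = "\<lambda>K \<omega>. f (fold deposit_on (cell_word (sample \<omega>) (t / real (Suc K)) (Suc K)) empty_config)"
  have meas: "?F K \<in> borel_measurable M" for K
    using t by (intro cell_word_expectation(1)) auto
  have lim: "(\<lambda>K. ?F K \<omega>) \<longlonglongrightarrow> f (occupancy (sample \<omega>) t)" if "\<omega> \<in> space M" for \<omega>
  proof (rule tendsto_eventually)
    have "\<forall>\<^sub>F K in sequentially. occupancy (sample \<omega>) t =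
        fold deposit_on (cell_word (sample \<omega>) (t / real (Suc K)) (Suc K)) empty_config"
      using eventually_occupancy_cell_word[OF screened_paths_sample[OF that] t]
      by (subst eventually_sequentially_Suc)
    then show "\<forall>\<^sub>F K in sequentially. ?F K \<omega> = f (occupancy (sample \<omega>) t)"
      by eventually_elim simp
  qed
  have meas_lim: "(\<lambda>\<omega>. f (occupancy (sample \<omega>) t)) \<in> borel_measurable M"
    by (rule borel_measurable_LIMSEQ_real[OF lim meas])
  have one: "integrable M (\<lambda>\<omega>. 1 :: real)" by simp
  have limAE: "AE \<omega> in M. (\<lambda>K. ?F K \<omega>) \<longlonglongrightarrow> f (occupancy (sample \<omega>) t)"
    by (rule AE_I2) (rule lim)
  have bound: "AE \<omega> in M. norm (?F K \<omega>) \<le> 1" for K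
    using f by (intro AE_I2) simp
  show "integrable M (\<lambda>\<omega>. f (occupancy (sample \<omega>) t))"
    by (rule integrable_dominated_convergence[where s = ?F, OF meas_lim meas one limAE bound])
  have "(\<lambda>K. \<integral>\<omega>. ?F K \<omega> \<partial>M) \<longlonglongrightarrow> (\<integral>\<omega>. f (occupancy (sample \<omega>) t) \<partial>M)"
    by (rule integral_dominated_convergence[where s = ?F, OF meas_lim meas one limAE bound])
  then show "(\<lambda>K. cell_mean (exp (- (t / real (Suc K)))) (Suc K) f empty_config)
      \<longlonglongrightarrow> (\<integral>\<omega>. f (occupancy (sample \<omega>) t) \<partial>M)"
    using t by (subst (asm) cell_word_expectation(2)) auto
qed

text \<open>The number of arrivals up to time \<open>t\<close> is Poisson distributed with mean \<open>3 * t\<close>. The sum bounds the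
  probability of fewer than \<open>m0\<close> of them, generously because the factorials are omitted.\<close>

lemma occupancy_expectation_ge:
  fixes f :: "config \<Rightarrow> real"
  assumes t: "0 < t" and f: "\<And>c. 0 \<le> f c" "\<And>c. f c \<le> 1"
    and l: "0 \<le> l" "\<And>m. m0 \<le> m \<Longrightarrow> l \<le> word_mean m f empty_config"
  shows "l * (1 - (\<Sum>m<m0. (3 * t) ^ m * exp (- 3 * t))) \<le> (\<integral>\<omega>. f (occupancy (sample \<omega>) t) \<partial>M)"
proof -
  have "(\<lambda>K. (1 + 3 * t / real (Suc K)) ^ Suc K) \<longlonglongrightarrow> exp (3 * t)"
    using tendsto_exp_limit_sequentially[of "3 * t"] by (rule LIMSEQ_Suc)
  then have low: "(\<lambda>K. exp (- 3 * t) * l * ((1 + 3 * t / real (Suc K)) ^ Suc K - (\<Sum>m<m0. (3 * t) ^ m)))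
      \<longlonglongrightarrow> exp (- 3 * t) * l * (exp (3 * t) - (\<Sum>m<m0. (3 * t) ^ m))"
    by (intro tendsto_intros)
  have le: "exp (- 3 * t) * l * ((1 + 3 * t / real (Suc K)) ^ Suc K - (\<Sum>m<m0. (3 * t) ^ m))
      \<le> cell_mean (exp (- (t / real (Suc K)))) (Suc K) f empty_config" for K
    using t f(1) l by (intro cell_mean_exp_ge) auto
  have "exp (- 3 * t) * l * (exp (3 * t) - (\<Sum>m<m0. (3 * t) ^ m)) \<le> (\<integral>\<omega>. f (occupancy (sample \<omega>) t) \<partial>M)"
    by (rule LIMSEQ_le[OF low occupancy_expectation(2)[OF t f]]) (use le in blast)
  moreover have "exp (- 3 * t) * l * (exp (3 * t) - (\<Sum>m<m0. (3 * t) ^ m)) =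
      l * (exp (- 3 * t) * exp (3 * t) - (\<Sum>m<m0. (3 * t) ^ m * exp (- 3 * t)))"
    by (simp add: sum_distrib_left sum_distrib_right right_diff_distrib mult_ac)
  moreover have "exp (- 3 * t) * exp (3 * t) = 1" by (simp add: exp_add[symmetric])
  ultimately show ?thesis by (simp only:)
qed

text \<open>The lower bound is applied to \<open>f\<close> and to \<open>1 - f\<close>, which turns it into a two-sided estimate.\<close>

lemma occupancy_expectation_tendsto:
  fixes f :: "config \<Rightarrow> real"
  assumes f: "\<And>c. 0 \<le> f c" "\<And>c. f c \<le> 1"
    and L: "(\<lambda>m. word_mean m f empty_config) \<longlonglongrightarrow> L"
  shows "((\<lambda>t. \<integral>\<omega>. f (occupancy (sample \<omega>) t) \<partial>M) \<longlongrightarrow> L) at_top"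
proof -
  have lower: "\<forall>\<^sub>F t in at_top. a < (\<integral>\<omega>. g (occupancy (sample \<omega>) t) \<partial>M)"
    if g: "\<And>c. 0 \<le> g c" "\<And>c. g c \<le> 1" and lim: "(\<lambda>m. word_mean m g empty_config) \<longlonglongrightarrow> l" and "a < l"
    for g :: "config \<Rightarrow> real" and l a
  proof -
    \<comment> \<open>The bound has to be nonnegative for \<open>occupancy_expectation_ge\<close>.\<close>
    define b where "b = max 0 ((a + l) / 2)"
    have l: "0 \<le> l" using LIMSEQ_le_const[OF lim, of 0] word_mean_nonneg[of g] g(1) by auto
    show ?thesis
    proof (cases "a < 0")
      case True
      then show ?thesis using g(1) by (intro always_eventually allI) (auto intro: less_le_trans[OF True] integral_nonneg)
    next
      case False
      then have b: "0 \<le> b" "a < b" "b < l" using \<open>a < l\<close> by (auto simp: b_def)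
      obtain m0 where m0: "\<And>m. m0 \<le> m \<Longrightarrow> b \<le> word_mean m g empty_config"
        using order_tendstoD(1)[OF lim b(3)] by (auto simp: eventually_sequentially intro: less_imp_le)
      have "((\<lambda>t. (3 * t) ^ m * exp (- 3 * t)) \<longlongrightarrow> (0 :: real)) at_top" for m
      proof -
        have "filterlim (\<lambda>t::real. 3 * t) at_top at_top"
          by (rule filterlim_tendsto_pos_mult_at_top[OF tendsto_const _ filterlim_ident]) simp
        from filterlim_compose[OF tendsto_power_div_exp_0[of m] this]
        show ?thesis by (simp add: exp_minus divide_inverse)
      qed
      then have "((\<lambda>t. b * (1 - (\<Sum>m<m0. (3 * t) ^ m * exp (- 3 * t)))) \<longlongrightarrow> b * (1 - (\<Sum>m<m0. 0))) at_top"
        by (intro tendsto_intros)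
      then have "\<forall>\<^sub>F t in at_top. a < b * (1 - (\<Sum>m<m0. (3 * t) ^ m * exp (- 3 * t)))"
        using b by (intro order_tendstoD) auto
      then show ?thesis using eventually_gt_at_top[of 0]
      proof eventually_elim
        case (elim t)
        show ?case by (rule less_le_trans[OF elim(1) occupancy_expectation_ge[OF elim(2) g b(1) m0]])
      qed
    qed
  qed
  show ?thesis
  proof (rule order_tendstoI)
    fix a assume "a < L"
    then show "\<forall>\<^sub>F t in at_top. a < (\<integral>\<omega>. f (occupancy (sample \<omega>) t) \<partial>M)" using lower[OF f L] by blast
  next
    fix a assume a: "L < a"
    have "(\<lambda>m. word_mean m (\<lambda>c. 1 - f c) empty_config) \<longlonglongrightarrow> 1 - L"
      unfolding word_mean_complement by (intro tendsto_intros L)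
    then have "\<forall>\<^sub>F t in at_top. 1 - a < (\<integral>\<omega>. 1 - f (occupancy (sample \<omega>) t) \<partial>M)"
      using lower[of "\<lambda>c. 1 - f c" "1 - L" "1 - a"] f a by auto
    then show "\<forall>\<^sub>F t in at_top. (\<integral>\<omega>. f (occupancy (sample \<omega>) t) \<partial>M) < a"
      using eventually_gt_at_top[of 0]
    proof eventually_elim
      case (elim t)
      have "integrable M (\<lambda>\<omega>. f (occupancy (sample \<omega>) t))"
        by (rule occupancy_expectation(1)[where f = f, OF elim(2) f])
      then show ?case using elim(1) by (simp add: prob_space)
    qed
  qed
qed

lemma site_density_tendsto:
  assumes "x \<in> arrivable" "1 \<le> r"
  shows "((\<lambda>t. site_density M N t x r) \<longlongrightarrow> hit x (- int r, - int r)) at_top"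
proof -
  have "((\<lambda>t. \<integral>\<omega>. site_indicator x r (occupancy (sample \<omega>) t) \<partial>M) \<longlongrightarrow> hit x (- int r, - int r)) at_top"
    by (rule occupancy_expectation_tendsto[where f = "site_indicator x r"])
      (rule word_mean_occupancy_tendsto[OF assms(1)] | simp add: site_indicator_def)+
  moreover have "\<forall>\<^sub>F t in at_top. (\<integral>\<omega>. site_indicator x r (occupancy (sample \<omega>) t) \<partial>M) = site_density M N t x r"
    using eventually_gt_at_top[of 0]
  proof eventually_elim
    case (elim t)
    have "site_indicator x r (occupancy (sample \<omega>) t) = real (occupancy (sample \<omega>) t x r)" if "\<omega> \<in> space M" for \<omega>
    proof -
      have "occupancy (sample \<omega>) t x r \<in> {0, 1}"
        using admissible_occupancy[OF screened_paths_sample[OF that] elim] unfolding admissible_def by blast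
      then show ?thesis by (auto simp: site_indicator_def)
    qed
    then show ?case unfolding site_density_def by (intro Bochner_Integration.integral_cong) auto
  qed
  ultimately show ?thesis by (rule Lim_transform_eventually)
qed

lemma site_density_screen:
  assumes "x \<in> {-2, 2}" "1 \<le> r"
  shows "((\<lambda>t. site_density M N t x r) \<longlongrightarrow> 0) at_top"
proof (rule tendsto_eventually)
  show "\<forall>\<^sub>F t in at_top. site_density M N t x r = 0"
    using eventually_gt_at_top[of 0]
  proof eventually_elim
    case (elim t)
    have "occupancy (sample \<omega>) t x r = 0" if "\<omega> \<in> space M" for \<omega>
    proof -
      have adm: "admissible (occupancy (sample \<omega>) t)"
        by (rule admissible_occupancy[OF screened_paths_sample[OF that] elim])
      then have "r \<notin> layers_at (occupancy (sample \<omega>) t) x"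
        using assms(1) by (auto simp: admissible_def)
      then have "occupancy (sample \<omega>) t x r \<noteq> 1" using assms(2) by (simp add: layers_at_def)
      moreover have "occupancy (sample \<omega>) t x r \<in> {0, 1}" using adm unfolding admissible_def by blast
      ultimately show ?thesis by simp
    qed
    then have "(\<integral>\<omega>. real (occupancy (sample \<omega>) t x r) \<partial>M) = (\<integral>\<omega>. 0 \<partial>M)"
      by (intro Bochner_Integration.integral_cong) auto
    then show ?case by (simp add: site_density_def)
  qed
qed

lemma end_density_eq:
  assumes "x \<in> arrivable" "1 \<le> r"
  shows "end_density M N x r = hit x (- int r, - int r)"
  unfolding end_density_def by (rule tendsto_Lim[OF _ site_density_tendsto[OF assms]]) simp

lemma end_density_limit:
  assumes "x \<in> arrivable"
  shows "(\<lambda>r. end_density M N x r) \<longlonglongrightarrow> (10 - sqrt 5) / 19"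
proof (rule Lim_transform_eventually[OF hit_limits[OF assms]])
  show "\<forall>\<^sub>F r in sequentially. hit x (- int r, - int r) = end_density M N x r"
    using eventually_ge_at_top[of 1] by eventually_elim (simp add: end_density_eq[OF assms])
qed

end

theorem theorem2:
  fixes M :: "'a measure" and N :: "int \<Rightarrow> real \<Rightarrow> 'a \<Rightarrow> nat"
  assumes "screened_parking M N"
  shows "(\<forall>x\<in>positions. \<forall>r\<ge>1. ((\<lambda>t. site_density M N t x r) \<longlongrightarrow> end_density M N x r) at_top) \<and>
         (\<forall>x\<in>{-1, 0, 1}. (\<lambda>r. end_density M N x r) \<longlonglongrightarrow> limit_density M N x) \<and>
         limit_density M N 0 = (10 - sqrt 5) / 19 \<and>
         \<bar>(10 - sqrt 5) / 19 - 0.408628\<bar> < 5 / 10 ^ 7 \<and>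
         limit_density M N (-1) = limit_density M N 0 \<and>
         limit_density M N 1 = limit_density M N 0"
proof -
  interpret screened_parking M N by (rule assms)
  have density: "((\<lambda>t. site_density M N t x r) \<longlongrightarrow> end_density M N x r) at_top"
    if "x \<in> positions" "1 \<le> r" for x r
  proof -
    have "\<exists>l. ((\<lambda>t. site_density M N t x r) \<longlongrightarrow> l) at_top"
      using that site_density_tendsto[of x r] site_density_screen[of x r]
      by (auto simp: positions_def arrivable_def)
    then obtain l where l: "((\<lambda>t. site_density M N t x r) \<longlongrightarrow> l) at_top" by blast
    then have "end_density M N x r = l"
      unfolding end_density_def by (rule tendsto_Lim[rotated]) simp
    then show ?thesis using l by simp
  qed
  have limit: "limit_density M N x = (10 - sqrt 5) / 19" if "x \<in> arrivable" for x
    unfolding limit_density_def by (rule limI[OF end_density_limit[OF that]])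
  have members: "-1 \<in> arrivable" "0 \<in> arrivable" "1 \<in> arrivable"
    by (simp_all add: arrivable_def)
  show ?thesis
  proof (intro conjI ballI allI impI)
    fix x :: int and r :: nat assume "x \<in> positions" "1 \<le> r"
    then show "((\<lambda>t. site_density M N t x r) \<longlongrightarrow> end_density M N x r) at_top" by (rule density)
  next
    fix x :: int assume "x \<in> {-1, 0, 1}"
    then have x: "x \<in> arrivable" unfolding arrivable_def .
    show "(\<lambda>r. end_density M N x r) \<longlonglongrightarrow> limit_density M N x"
      unfolding limit[OF x] by (rule end_density_limit[OF x])
  next
    have "2.23606 < sqrt 5" by (rule real_less_rsqrt) (simp add: power2_eq_square)
    moreover have "sqrt 5 < 2.236077" by (rule real_less_lsqrt) (simp_all add: power2_eq_square)
    ultimately show "\<bar>(10 - sqrt 5) / 19 - 0.408628\<bar> < 5 / 10 ^ 7"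
      unfolding abs_less_iff by (simp add: field_simps)
  qed (simp_all only: limit members)
qed

end
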